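(* Let $n,d,h\ge1$, let $\lambda\vdash h$, and let $(i_1,\dots,i_h)\in\{1,\dots,n\}^h$, $(j_1,\dots,j_h)\in\{1,\dots,d\}^h$. The immanant $imm_\lambda(i_1i_2\cdots i_h;j_1j_2\cdots j_h)\in\mathbb C_h[M_{n,d}]$ can be written as a linear combination of standard right symmetrized bitableaux of the same shape $\lambda$: $$imm_\lambda(i_1i_2\cdots i_h;j_1j_2\cdots j_h)=\sum_{U,V}\varrho_{U,V}\,(U|\boxed{V}),\qquad\varrho_{U,V}\in\mathbb C,$$ where $U$ ranges over standard tableaux on $\{1,\dots,n\}$, $V$ over standard tableaux on $\{1,\dots,d\}$, and $sh(U)=sh(V)=\lambda$.
   Context: $\mathbb C[M_{n,d}]$ is the polynomial algebra in commuting variables $(i|j)$, $1\le i\le n$, $1\le j\le d$; $\mathbb C_h[M_{n,d}]$ is its homogeneous component of degree $h$. For words of equal length $p$, $(i_1\cdots i_p|j_1\cdots j_p)=(-1)^{\binom p2}\det\big((i_r|j_s)\big)_{r,s=1,\dots,p}$. A Young tableau of shape $\lambda\vdash h$ over an alphabet is an arbitrary filling of the diagram of $\lambda$; $sh(\cdot)$ denotes the shape. It is standard if its rows are strictly increasing from left to right and its columns non-decreasing from top to bottom. For tableaux $S$ on $\{1,\dots,n\}$ and $T$ on $\{1,\dots,d\}$ of the same shape with row words $\omega_1,\dots,\omega_p$ and $\varpi_1,\dots,\varpi_p$, the bitableau is $$(S|T)=(-1)^{\sum_{k=2}^p\ell(\omega_k)(\ell(\varpi_1)+\cdots+\ell(\varpi_{k-1}))}(\omega_1|\varpi_1)\cdots(\omega_p|\varpi_p),$$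 $\ell$ denoting word length. In particular a column bitableau (shape $(1^h)$) is $$\left(\begin{array}{c}i_1\\ \vdots\\ i_h\end{array}\right|\left.\begin{array}{c}j_1\\ \vdots\\ j_h\end{array}\right)=(-1)^{\binom h2}(i_1|j_1)\cdots(i_h|j_h).$$ The right symmetrized bitableau is $(S|\boxed{T})=\sum_{\overline T}(S|\overline T)$, the sum over all tableaux $\overline T$ obtained by permuting the cells within each column of $T$ (one summand for each tuple of column permutations, so repeated entries in a column give multiplicities). For $\lambda\vdash h$, $\chi^\lambda$ is the irreducible character of the symmetric group $\mathbf S_h$ labelled so that $\lambda=(1^h)$ gives the trivial and $\lambda=(h)$ the sign character (i.e. the character usually attached to the conjugate partition). The immanant is $$imm_\lambda(i_1\cdots i_h;j_1\cdots j_h)=\sum_{\sigma\in\mathbf S_h}\chi^\lambda(\sigma)\left(\begin{array}{c}i_{\sigma(1)}\\ \vdots\\ i_{\sigma(h)}\end{array}\right|\left.\begin{array}{c}j_1\\ \vdots\\ j_h\end{array}\right).$$ *)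

theory Defs
  imports
    "HOL-Library.Poly_Mapping"
    "HOL-Library.Function_Algebras"
    "HOL-Combinatorics.Permutations"
    "Jordan_Normal_Form.Determinant"
begin

section \<open>The polynomial algebra in the variables \<open>(i|j)\<close>\<close>

text \<open>Complex polynomials in variables indexed by all of \<open>nat \<times> nat\<close>; the polynomials that
  involve only the variables of \<open>\<complex>[M\<^sub>n\<^sub>,\<^sub>d]\<close> are cut out in \<open>hom_component\<close>.\<close>

type_synonym lpoly = "((nat \<times> nat) \<Rightarrow>\<^sub>0 nat) \<Rightarrow>\<^sub>0 complex"

definition lconst :: "complex \<Rightarrow> lpoly" where
  "lconst a = Poly_Mapping.single 0 a"

definition lvar :: "nat \<Rightarrow> nat \<Rightarrow> lpoly" where
  "lvar i j = Poly_Mapping.single (Poly_Mapping.single (i, j) 1) 1"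

definition hom_component :: "nat \<Rightarrow> nat \<Rightarrow> nat \<Rightarrow> lpoly set" where
  "hom_component n d h =
    {p. \<forall>m \<in> Poly_Mapping.keys p.
          Poly_Mapping.keys m \<subseteq> {1..n} \<times> {1..d} \<and>
          (\<Sum>x \<in> Poly_Mapping.keys m. Poly_Mapping.lookup m x) = h}"


section \<open>Partitions and tableaux\<close>

definition is_partition :: "nat list \<Rightarrow> nat \<Rightarrow> bool" where
  "is_partition lam h \<longleftrightarrow> sorted_wrt (\<ge>) lam \<and> (\<forall>k \<in> set lam. 1 \<le> k) \<and> sum_list lam = h"

definition conj_partition :: "nat list \<Rightarrow> nat list" where
  "conj_partition lam = map (\<lambda>c. length (filter (\<lambda>r. c < r) lam)) [0..<foldr max lam 0]"

text \<open>A cell is a pair (row, column), both counted from 0.\<close>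

definition cells :: "nat list \<Rightarrow> (nat \<times> nat) set" where
  "cells lam = {(r, c). r < length lam \<and> c < lam ! r}"

text \<open>A tableau is the list of its row words.\<close>

type_synonym tableau = "nat list list"

definition shape :: "tableau \<Rightarrow> nat list" where
  "shape T = map length T"

definition standard :: "tableau \<Rightarrow> bool" where
  "standard T \<longleftrightarrow>
    (\<forall>w \<in> set T. sorted_wrt (<) w) \<and>
    (\<forall>r c. Suc r < length T \<longrightarrow> c < length (T ! r) \<longrightarrow> c < length (T ! Suc r) \<longrightarrow>
       T ! r ! c \<le> T ! Suc r ! c)"

definition standard_tableaux :: "nat list \<Rightarrow> nat \<Rightarrow> tableau set" where
  "standard_tableaux lam n =
    {T. shape T = lam \<and> (\<forall>w \<in> set T. set w \<subseteq> {1..n}) \<and> standard T}"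

lemma finite_standard_tableaux: "finite (standard_tableaux lam n)"
proof (rule finite_subset)
  show "standard_tableaux lam n \<subseteq>
      {T. set T \<subseteq> {w. set w \<subseteq> {1..n} \<and> length w \<le> sum_list lam} \<and> length T = length lam}"
  proof
    fix T assume T: "T \<in> standard_tableaux lam n"
    then have sh: "map length T = lam" by (simp add: standard_tableaux_def shape_def)
    have "length w \<le> sum_list lam" if "w \<in> set T" for w
      using that unfolding sh[symmetric] by (intro member_le_sum_list) simp_all
    moreover have "length T = length lam" using sh by auto
    ultimately show "T \<in> {T. set T \<subseteq> {w. set w \<subseteq> {1..n} \<and> length w \<le> sum_list lam} \<and>
        length T = length lam}"
      using T by (auto simp: standard_tableaux_def)
  qed
  show "finite {T. set T \<subseteq> {w. set w \<subseteq> {1..n} \<and> length w \<le> sum_list lam} \<and>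
      length T = length lam}"
    by (intro finite_lists_length_eq finite_lists_length_le) simp
qed


section \<open>Bitableaux\<close>

definition biproduct :: "nat list \<Rightarrow> nat list \<Rightarrow> lpoly" where
  "biproduct u v =
    (-1) ^ (length u choose 2) *
    det (mat (length u) (length u) (\<lambda>(r, s). lvar (u ! r) (v ! s)))"

text \<open>Only meaningful when \<open>shape S = shape T\<close>.\<close>

definition bitableau :: "tableau \<Rightarrow> tableau \<Rightarrow> lpoly" where
  "bitableau S T =
    (-1) ^ (\<Sum>k<length S. length (S ! k) * (\<Sum>m<k. length (T ! m))) *
    (\<Prod>k<length S. biproduct (S ! k) (T ! k))"

definition column_bitableau :: "nat list \<Rightarrow> nat list \<Rightarrow> lpoly" where
  "column_bitableau u v = bitableau (map (\<lambda>a. [a]) u) (map (\<lambda>a. [a]) v)"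

lemma column_bitableau_eq:
  assumes "length u = length v"
  shows "column_bitableau u v =
    (-1) ^ (length u choose 2) * (\<Prod>k<length u. lvar (u ! k) (v ! k))"
proof -
  have 1: "biproduct [a] [b] = lvar a b" for a b
    by (simp add: biproduct_def det_single binomial_eq_0)
  have 2: "(\<Sum>k<length u. length (map (\<lambda>a. [a]) u ! k) *
      (\<Sum>m<k. length (map (\<lambda>a. [a]) v ! m))) = length u choose 2"
  proof -
    have "(\<Sum>k<length u. length (map (\<lambda>a. [a]) u ! k) *
        (\<Sum>m<k. length (map (\<lambda>a. [a]) v ! m))) = (\<Sum>k<length u. k)"
      using assms by (intro sum.cong) auto
    also have "\<dots> = length u choose 2"
      by (induction "length u" arbitrary: u) 
         (simp_all add: lessThan_atLeast0 gauss_sum_nat choose_two Sum_Ico_nat)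
    finally show ?thesis .
  qed
  show ?thesis
    unfolding column_bitableau_def bitableau_def 2[unfolded length_map]
    using assms 2 by (simp add: 1)
qed

text \<open>Column permutations: a tuple of permutations, one for each column, is a permutation of the
  set of cells that maps every column to itself.\<close>

definition column_perms :: "nat list \<Rightarrow> (nat \<times> nat \<Rightarrow> nat \<times> nat) set" where
  "column_perms lam = {\<pi>. \<pi> permutes cells lam \<and> (\<forall>x \<in> cells lam. snd (\<pi> x) = snd x)}"

definition permute_tableau :: "(nat \<times> nat \<Rightarrow> nat \<times> nat) \<Rightarrow> tableau \<Rightarrow> tableau" where
  "permute_tableau \<pi> T =
    map (\<lambda>r. map (\<lambda>c. case \<pi> (r, c) of (r', c') \<Rightarrow> T ! r' ! c') [0..<length (T ! r)])
      [0..<length T]"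

definition right_sym_bitableau :: "tableau \<Rightarrow> tableau \<Rightarrow> lpoly" where
  "right_sym_bitableau S T = (\<Sum>\<pi> \<in> column_perms (shape T). bitableau S (permute_tableau \<pi> T))"


section \<open>Irreducible characters of the symmetric group\<close>

text \<open>The symmetric group on \<open>h\<close> letters consists of the permutations of \<open>{..<h}\<close>, and elements of
  its group algebra are functions \<open>(nat \<Rightarrow> nat) \<Rightarrow> complex\<close> vanishing outside that group.\<close>

type_synonym galg = "(nat \<Rightarrow> nat) \<Rightarrow> complex"

definition gscale :: "complex \<Rightarrow> galg \<Rightarrow> galg" where
  "gscale a f = (\<lambda>p. a * f p)"

interpretation galg: vector_space gscale
  by unfold_locales (auto simp: gscale_def algebra_simps fun_eq_iff)

definition gbasis :: "(nat \<Rightarrow> nat) \<Rightarrow> galg" where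
  "gbasis p = (\<lambda>q. if q = p then 1 else 0)"

text \<open>Left multiplication by the group element \<open>s\<close>.\<close>

definition gleft :: "(nat \<Rightarrow> nat) \<Rightarrow> galg \<Rightarrow> galg" where
  "gleft s f = (\<lambda>p. f (inv_into UNIV s \<circ> p))"

lemma gleft_gbasis:
  assumes "bij s"
  shows "gleft s (gbasis p) = gbasis (s \<circ> p)"
proof -
  have "inv_into UNIV s \<circ> q = p \<longleftrightarrow> q = s \<circ> p" for q
    using assms
    by (metis bij_is_inj bij_is_surj comp_assoc comp_id fun.map_comp id_comp inv_o_cancel surj_iff)
  then show ?thesis by (auto simp: gleft_def gbasis_def fun_eq_iff)
qed

text \<open>The trace of a linear endomorphism \<open>f\<close> of a finite-dimensional subspace \<open>W\<close>,
  computed in an arbitrarily chosen basis of \<open>W\<close>.\<close>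

definition trace_on :: "galg set \<Rightarrow> (galg \<Rightarrow> galg) \<Rightarrow> complex" where
  "trace_on W f =
    (let B = (SOME B. B \<subseteq> W \<and> \<not> galg.dependent B \<and> galg.span B = W)
     in \<Sum>b\<in>B. galg.representation B (f b) b)"

text \<open>The cells of the diagram of \<open>mu\<close> in reading order, row by row: the letter \<open>k\<close> sits in the
  cell \<open>cell_list mu ! k\<close>.\<close>

definition cell_list :: "nat list \<Rightarrow> (nat \<times> nat) list" where
  "cell_list mu = concat (map (\<lambda>r. map (Pair r) [0..<mu ! r]) [0..<length mu])"

definition row_group :: "nat list \<Rightarrow> (nat \<Rightarrow> nat) set" where
  "row_group mu = {p. p permutes {..<sum_list mu} \<and>
    (\<forall>k<sum_list mu. fst (cell_list mu ! p k) = fst (cell_list mu ! k))}"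

definition column_group :: "nat list \<Rightarrow> (nat \<Rightarrow> nat) set" where
  "column_group mu = {p. p permutes {..<sum_list mu} \<and>
    (\<forall>k<sum_list mu. snd (cell_list mu ! p k) = snd (cell_list mu ! k))}"

definition young_symmetrizer :: "nat list \<Rightarrow> galg" where
  "young_symmetrizer mu =
    (\<Sum>p \<in> row_group mu. \<Sum>q \<in> column_group mu. gscale (of_int (sign q)) (gbasis (p \<circ> q)))"

text \<open>The left ideal of the group algebra generated by the Young symmetrizer.\<close>

definition specht_module :: "nat list \<Rightarrow> galg set" where
  "specht_module mu =
    galg.span {gleft s (young_symmetrizer mu) | s. s permutes {..<sum_list mu}}"

text \<open>The usual labelling: \<open>specht_character [h]\<close> is the trivial character and
  \<open>specht_character (replicate h 1)\<close> is the sign character.\<close>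

definition specht_character :: "nat list \<Rightarrow> (nat \<Rightarrow> nat) \<Rightarrow> complex" where
  "specht_character mu s = trace_on (specht_module mu) (gleft s)"

definition irr_character :: "nat list \<Rightarrow> (nat \<Rightarrow> nat) \<Rightarrow> complex" where
  "irr_character lam = specht_character (conj_partition lam)"


section \<open>Immanants\<close>

definition imm :: "nat list \<Rightarrow> nat list \<Rightarrow> nat list \<Rightarrow> lpoly" where
  "imm lam iw jw =
    (\<Sum>\<sigma> | \<sigma> permutes {..<length iw}.
       lconst (irr_character lam \<sigma>) *
       column_bitableau (map (\<lambda>k. iw ! \<sigma> k) [0..<length iw]) jw)"

end

theory Submission
  imports Defs
begin

text \<open>
  The character of the left ideal generated by the Young symmetrizer \<open>c\<close> is a combination of the
  functions \<open>s \<mapsto> f (s \<cdot> t \<cdot> c)\<close> with \<open>f\<close> a linear functional on the group algebra. Substituting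
  \<open>p = s t r q\<close> turns the corresponding part of the immanant into a combination of sums over row
  and column permutations of one filling, and each of these is, up to sign, a right symmetrized
  bitableau of shape \<open>\<lambda>\<close> with arbitrary entries.

  Seen as a function of the left tableau, a right symmetrized bitableau is antisymmetric in the rows
  and then symmetrized over the columns; seen as a function of the right tableau it is symmetric in
  the columns and then antisymmetrized over the rows. In both cases it satisfies Garnir relations,
  and each relation expresses a non-standard filling by fillings of larger weight (sum of entries
  times line number), so that straightening terminates. One argument covers both tableaux because
  the second case is the first one with rows and columns, and the two characters of the symmetric
  group, exchanged.
\<close>

subsection \<open>Polynomials as a complex vector space\<close>

definition lpscale :: "complex \<Rightarrow> lpoly \<Rightarrow> lpoly" where
  "lpscale a p = lconst a * p"

lemma lconst_add: "lconst (a + b) = lconst a + lconst b"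
  by (simp add: lconst_def single_add)

lemma lconst_mult: "lconst (a * b) = lconst a * lconst b"
  by (simp add: lconst_def mult_single)

lemma lconst_1 [simp]: "lconst 1 = 1"
  by (simp add: lconst_def)

lemma lconst_0 [simp]: "lconst 0 = 0"
  by (simp add: lconst_def)

interpretation lp: vector_space lpscale
  by unfold_locales (simp_all add: lpscale_def lconst_add lconst_mult algebra_simps)

lemma lconst_minus: "lconst (- a) = - lconst a"
  using lp.scale_minus_left[of a 1] by (simp add: lpscale_def)

lemma lconst_of_nat: "lconst (of_nat m) = of_nat m"
  by (induction m) (simp_all add: lconst_add)

lemma lconst_of_int: "lconst (of_int z) = of_int z"
  by (cases z rule: int_cases2) (simp_all add: lconst_minus lconst_of_nat)

lemma lconst_sum: "lconst (sum f A) = (\<Sum>x\<in>A. lconst (f x))"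
  by (induction A rule: infinite_finite_induct) (simp_all add: lconst_add)

lemma lp_span_lconst: "p \<in> lp.span S \<Longrightarrow> lconst a * p \<in> lp.span S"
  using lp.span_scale[of p S a] by (simp add: lpscale_def)

lemma lp_span_of_int: "p \<in> lp.span S \<Longrightarrow> of_int z * p \<in> lp.span S"
  using lp_span_lconst[of p S "of_int z"] by (simp add: lconst_of_int)

lemma lp_span_trans:
  assumes "x \<in> lp.span A" "\<And>a. a \<in> A \<Longrightarrow> a \<in> lp.span B"
  shows "x \<in> lp.span B"
  using lp.span_minimal[of A "lp.span B"] lp.subspace_span assms by blast

lemma lp_span_of_nat_cancel:
  assumes "of_nat m * p \<in> lp.span S" "m > 0"
  shows "p \<in> lp.span S"
proof -
  have "lconst (inverse (of_nat m)) * (lconst (of_nat m) * p) \<in> lp.span S"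
    using assms lp_span_lconst[of "of_nat m * p"] by (simp add: lconst_of_nat)
  also have "lconst (inverse (of_nat m)) * (lconst (of_nat m) * p) = p"
    using assms(2) by (simp add: mult.assoc[symmetric] lconst_mult[symmetric])
  finally show ?thesis .
qed

text \<open>Here \<open>2 * p = 0\<close> lies in the span of the empty set, which is the zero
  space, and cancelling the factor puts \<open>p\<close> there as well.\<close>

lemma lp_eq_minus_self_imp_zero:
  assumes "(p :: lpoly) = - p"
  shows "p = 0"
proof -
  have "p + p = 0" using assms by (simp only: eq_neg_iff_add_eq_0)
  then have "of_nat 2 * p = 0" by (simp only: of_nat_numeral mult_2)
  then have "of_nat 2 * p \<in> lp.span {}" by simp
  from lp_span_of_nat_cancel[OF this] show ?thesis by simp
qed

subsection \<open>Permutations preserving the fibers of a function\<close>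

text \<open>The notation \<open>inv\<close> is occupied by the group inverse of HOL-Algebra.\<close>

abbreviation pinv :: "('a \<Rightarrow> 'a) \<Rightarrow> 'a \<Rightarrow> 'a" where
  "pinv \<equiv> inv_into UNIV"

text \<open>With the row or the column number as \<open>f\<close> these are the row or the column
  permutations of a diagram; with a constant \<open>f\<close> they are all permutations of
  \<open>A\<close>. The reindexing lemmas below thus serve all three groups.\<close>

definition fiber_perms :: "'a set \<Rightarrow> ('a \<Rightarrow> 'b) \<Rightarrow> ('a \<Rightarrow> 'a) set" where
  "fiber_perms A f = {p. p permutes A \<and> (\<forall>x\<in>A. f (p x) = f x)}"

lemma fiber_permsD:
  assumes "p \<in> fiber_perms A f"
  shows "p permutes A" "x \<in> A \<Longrightarrow> f (p x) = f x"
  using assms by (auto simp: fiber_perms_def)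

lemma fiber_perms_inv:
  assumes "p \<in> fiber_perms A f"
  shows "pinv p \<in> fiber_perms A f"
proof -
  note p = fiber_permsD[OF assms]
  have "f (pinv p x) = f x" if "x \<in> A" for x
    using p(2)[of "pinv p x"] permutes_inverses(1)[OF p(1)] permutes_in_image[OF permutes_inv[OF p(1)]] that
    by auto
  then show ?thesis using p(1) by (auto simp: fiber_perms_def permutes_inv)
qed

lemma fiber_perms_compose:
  assumes "p \<in> fiber_perms A f" "q \<in> fiber_perms A f"
  shows "p \<circ> q \<in> fiber_perms A f"
  using assms by (auto simp: fiber_perms_def permutes_compose permutes_in_image)

lemma fiber_perms_transpose:
  assumes "x \<in> A" "y \<in> A" "f x = f y"
  shows "Transposition.transpose x y \<in> fiber_perms A f"
  using assms by (auto simp: fiber_perms_def permutes_swap_id Transposition.transpose_def)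

lemma fiber_perms_of_subset:
  assumes "p permutes X" "X \<subseteq> A" "\<And>x y. x \<in> X \<Longrightarrow> y \<in> X \<Longrightarrow> f x = f y"
  shows "p \<in> fiber_perms A f"
proof -
  have "f (p x) = f x" for x
  proof (cases "x \<in> X")
    case True
    then show ?thesis using permutes_in_image[OF assms(1), of x] by (intro assms(3)) simp_all
  qed (simp add: permutes_not_in[OF assms(1)])
  then show ?thesis using assms(1,2) by (auto simp: fiber_perms_def permutes_subset)
qed

lemma sum_fiber_perms_inv:
  "(\<Sum>p\<in>fiber_perms A f. g (pinv p)) = (\<Sum>p\<in>fiber_perms A f. g p)"
  by (rule sum.reindex_bij_witness[of _ pinv pinv])
     (simp_all add: fiber_perms_inv inv_inv_eq[OF permutes_bij[OF fiber_permsD(1)]])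

lemma sum_fiber_perms_compose_left:
  assumes "k \<in> fiber_perms A f"
  shows "(\<Sum>p\<in>fiber_perms A f. g (k \<circ> p)) = (\<Sum>p\<in>fiber_perms A f. g p)"
proof (rule sum.reindex_bij_witness[of _ "\<lambda>p. pinv k \<circ> p" "\<lambda>p. k \<circ> p"])
  have k: "pinv k \<circ> k = id" "k \<circ> pinv k = id"
    using permutes_inv_o[OF fiber_permsD(1)[OF assms]] by auto
  show "pinv k \<circ> (k \<circ> p) = p" "k \<circ> (pinv k \<circ> p) = p" for p
    using k by (simp_all add: comp_assoc[symmetric])
qed (use assms in \<open>simp_all add: fiber_perms_compose fiber_perms_inv\<close>)

lemma sum_fiber_perms_compose_right:
  assumes "k \<in> fiber_perms A f"
  shows "(\<Sum>p\<in>fiber_perms A f. g (p \<circ> k)) = (\<Sum>p\<in>fiber_perms A f. g p)"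
proof (rule sum.reindex_bij_witness[of _ "\<lambda>p. p \<circ> pinv k" "\<lambda>p. p \<circ> k"])
  have k: "pinv k \<circ> k = id" "k \<circ> pinv k = id"
    using permutes_inv_o[OF fiber_permsD(1)[OF assms]] by auto
  show "(p \<circ> k) \<circ> pinv k = p" "(p \<circ> pinv k) \<circ> k = p" for p
    using k by (simp_all add: comp_assoc)
qed (use assms in \<open>simp_all add: fiber_perms_compose fiber_perms_inv\<close>)

text \<open>A Boolean selects the sign or the trivial character, so that negating it gives the other
  of the two.\<close>

definition chi :: "bool \<Rightarrow> ('a \<Rightarrow> 'a) \<Rightarrow> int" where
  "chi b p = (if b then sign p else 1)"

lemma chi_compose:
  assumes "finite A" "p permutes A" "q permutes A"
  shows "chi b (p \<circ> q) = chi b p * chi b q"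
  using sign_compose[OF permutes_imp_permutation[OF assms(1,2)] permutes_imp_permutation[OF assms(1,3)]]
  by (simp add: chi_def)

lemma chi_square: "chi b p * chi b p = 1"
  by (simp add: chi_def)

lemma chi_transpose: "x \<noteq> y \<Longrightarrow> chi b (Transposition.transpose x y) = (if b then -1 else 1)"
  by (simp add: chi_def sign_swap_id)

subsection \<open>The exchange step\<close>

text \<open>As many entries of size at least \<open>v\<close> enter \<open>Y\<close> as entries of
  size at most \<open>v\<close> leave it, so the sum over \<open>Y\<close> cannot drop. If it stays
  the same, all entries that cross equal \<open>v\<close>; the multisets of entries on
  \<open>X\<close> and on \<open>Y\<close> are then unchanged, and a rearrangement inside
  \<open>X\<close> and inside \<open>Y\<close> has the same effect on \<open>S\<close> as
  \<open>\<sigma>\<close>.\<close>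

lemma sum_over_exchange:
  fixes S :: "'a \<Rightarrow> nat"
  assumes fin: "finite X" "finite Y" and disj: "X \<inter> Y = {}"
    and s: "\<sigma> permutes X \<union> Y"
    and vX: "\<And>x. x \<in> X \<Longrightarrow> v \<le> S x" and vY: "\<And>y. y \<in> Y \<Longrightarrow> S y \<le> v"
  shows "(\<Sum>y\<in>Y. S y) \<le> (\<Sum>y\<in>Y. S (\<sigma> y))"
    and "(\<Sum>y\<in>Y. S (\<sigma> y)) = (\<Sum>y\<in>Y. S y) \<Longrightarrow>
      \<exists>\<rho> \<rho>'. \<rho> permutes X \<and> \<rho>' permutes Y \<and> S \<circ> \<sigma> = S \<circ> (\<rho> \<circ> \<rho>')"
proof -
  \<comment> \<open>\<open>A\<close> holds the cells of \<open>X\<close> whose entries are brought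
    into \<open>Y\<close>, and \<open>B\<close> the cells of \<open>Y\<close> whose entries leave
    it.\<close>
  define A B I where "A = \<sigma> ` Y - Y" and "B = Y - \<sigma> ` Y" and "I = Y \<inter> \<sigma> ` Y"
  have inj: "inj_on \<sigma> T" for T using permutes_inj[OF s] by (rule inj_on_subset) simp
  have fins: "finite A" "finite B" "finite I" using fin by (auto simp: A_def B_def I_def)
  have Y: "Y = I \<union> B" "I \<inter> B = {}" and sY: "\<sigma> ` Y = I \<union> A" "I \<inter> A = {}"
    by (auto simp: A_def B_def I_def)
  have AX: "A \<subseteq> X" using permutes_image[OF s] by (auto simp: A_def)
  have BY: "B \<subseteq> Y" by (auto simp: B_def)
  have "card (\<sigma> ` Y) = card Y" using inj by (rule card_image)
  moreover have "card Y = card I + card B"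
    by (subst Y(1)) (simp only: card_Un_disjoint fins Y(2))
  moreover have "card (\<sigma> ` Y) = card I + card A"
    by (simp only: sY card_Un_disjoint fins)
  ultimately have cardAB: "card A = card B" by simp
  have sumY: "(\<Sum>y\<in>Y. S y) = sum S I + sum S B"
    by (subst Y(1)) (simp add: sum.union_disjoint fins Y(2))
  have sumsY: "(\<Sum>y\<in>Y. S (\<sigma> y)) = sum S I + sum S A"
  proof -
    have "(\<Sum>y\<in>Y. S (\<sigma> y)) = sum S (\<sigma> ` Y)" using sum.reindex[OF inj, of S Y] by (simp add: o_def)
    then show ?thesis by (simp add: sY sum.union_disjoint fins)
  qed
  have A: "card A * v \<le> sum S A" using sum_bounded_below[of A v S] vX AX by auto
  have B: "sum S B \<le> card B * v" using sum_bounded_above[of B S v] vY BY by auto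
  show "(\<Sum>y\<in>Y. S y) \<le> (\<Sum>y\<in>Y. S (\<sigma> y))"
    using A B cardAB unfolding sumY sumsY by simp
  assume "(\<Sum>y\<in>Y. S (\<sigma> y)) = (\<Sum>y\<in>Y. S y)"
  then have eqA: "sum S A = (\<Sum>x\<in>A. v)" and eqB: "sum S B = (\<Sum>x\<in>B. v)"
    using A B cardAB unfolding sumY sumsY by simp_all
  have SA: "S x = v" if "x \<in> A" for x
    using sum_mono_inv[OF eqA[symmetric] _ that fins(1)] vX AX by auto
  have SB: "S x = v" if "x \<in> B" for x
    using sum_mono_inv[OF eqB _ that fins(2)] vY BY by auto
  have "image_mset S (mset_set A) = image_mset (\<lambda>_. v) (mset_set A)"
    by (rule image_mset_cong) (simp add: SA fins)
  moreover have "image_mset S (mset_set B) = image_mset (\<lambda>_. v) (mset_set B)"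
    by (rule image_mset_cong) (simp add: SB fins)
  ultimately have AB: "image_mset S (mset_set A) = image_mset S (mset_set B)"
    using cardAB by (simp add: image_mset_const_eq)
  have img: "image_mset (S \<circ> \<sigma>) (mset_set T) = image_mset S (mset_set (\<sigma> ` T))" for T
    by (simp add: image_mset_mset_set[OF inj, symmetric] multiset.map_comp)
  have "image_mset S (mset_set (\<sigma> ` Y)) = image_mset S (mset_set (I \<union> B))"
    using AB unfolding sY(1) by (simp add: mset_set_Union fins Y(2) sY(2))
  then have mY: "image_mset (S \<circ> \<sigma>) (mset_set Y) = image_mset S (mset_set Y)"
    unfolding img using Y(1) by simp
  \<comment> \<open>The multiset over all of \<open>X \<union> Y\<close> is invariant, so removing
    the equal parts over \<open>Y\<close> leaves equality over \<open>X\<close>.\<close>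
  have "image_mset (S \<circ> \<sigma>) (mset_set (X \<union> Y)) = image_mset S (mset_set (X \<union> Y))"
    unfolding img permutes_image[OF s] ..
  then have mX: "image_mset (S \<circ> \<sigma>) (mset_set X) = image_mset S (mset_set X)"
    using mY by (simp add: mset_set_Union fin disj)
  obtain \<rho> where \<rho>: "\<rho> permutes X" "\<forall>x\<in>X. (S \<circ> \<sigma>) x = S (\<rho> x)"
    using image_mset_eq_implies_permutes[OF fin(1) mX] by auto
  obtain \<rho>' where \<rho>': "\<rho>' permutes Y" "\<forall>x\<in>Y. (S \<circ> \<sigma>) x = S (\<rho>' x)"
    using image_mset_eq_implies_permutes[OF fin(2) mY] by auto
  have "(S \<circ> \<sigma>) x = (S \<circ> (\<rho> \<circ> \<rho>')) x" for x
  proof -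
    consider "x \<in> X" "x \<notin> Y" | "x \<in> Y" "\<rho>' x \<notin> X" | "x \<notin> X" "x \<notin> Y"
      using disj permutes_in_image[OF \<rho>'(1), of x] by blast
    then show ?thesis
      by cases (use \<rho> \<rho>' in \<open>auto simp: permutes_not_in permutes_not_in[OF s]\<close>)
  qed
  then show "\<exists>\<rho> \<rho>'. \<rho> permutes X \<and> \<rho>' permutes Y \<and> S \<circ> \<sigma> = S \<circ> (\<rho> \<circ> \<rho>')"
    using \<rho>(1) \<rho>'(1) by blast
qed

text \<open>By \<open>sum_over_exchange\<close> every \<open>\<sigma>\<close> in the relation either
  raises the sum over \<open>Y\<close> or acts on \<open>S\<close> like a permutation inside
  \<open>X\<close> and \<open>Y\<close>. Each term of the second kind equals \<open>F S\<close>,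
  because its sign occurs twice, so \<open>F S\<close> has a positive integer multiplicity and the
  relation can be solved for it.\<close>

lemma garnir_step:
  fixes F :: "('a \<Rightarrow> nat) \<Rightarrow> lpoly"
  assumes fin: "finite X" "finite Y" and disj: "X \<inter> Y = {}"
    and equiv: "\<And>\<rho> \<rho>'. \<rho> permutes X \<Longrightarrow> \<rho>' permutes Y \<Longrightarrow>
      F (S \<circ> (\<rho> \<circ> \<rho>')) = of_int (chi b (\<rho> \<circ> \<rho>')) * F S"
    and rel: "(\<Sum>\<sigma> | \<sigma> permutes X \<union> Y. of_int (chi b \<sigma>) * F (S \<circ> \<sigma>)) = 0"
    and vX: "\<And>x. x \<in> X \<Longrightarrow> v \<le> S x" and vY: "\<And>y. y \<in> Y \<Longrightarrow> S y \<le> v"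
    and inj: "b \<Longrightarrow> inj_on S (X \<union> Y)"
  shows "F S \<in> lp.span {F (S \<circ> \<sigma>) | \<sigma>. \<sigma> permutes X \<union> Y \<and> (\<Sum>y\<in>Y. S y) < (\<Sum>y\<in>Y. S (\<sigma> y))}"
    (is "_ \<in> lp.span ?W")
proof -
  define G where "G = {\<sigma>. \<sigma> permutes X \<union> Y}"
  define E where "E = {\<sigma>\<in>G. (\<Sum>y\<in>Y. S (\<sigma> y)) = (\<Sum>y\<in>Y. S y)}"
  have finG: "finite G" using fin by (simp add: G_def finite_permutations)
  have EG: "E \<subseteq> G" by (auto simp: E_def)
  have E: "of_int (chi b \<sigma>) * F (S \<circ> \<sigma>) = F S" if "\<sigma> \<in> E" for \<sigma>
  proof -
    have s: "\<sigma> permutes X \<union> Y" and eq: "(\<Sum>y\<in>Y. S (\<sigma> y)) = (\<Sum>y\<in>Y. S y)"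
      using that by (auto simp: E_def G_def)
    obtain \<rho> \<rho>' where \<rho>: "\<rho> permutes X" "\<rho>' permutes Y" and eq': "S \<circ> \<sigma> = S \<circ> (\<rho> \<circ> \<rho>')"
      using sum_over_exchange(2)[OF fin disj s vX vY eq] by auto
    \<comment> \<open>Equal fillings alone do not determine the sign. When \<open>chi b\<close> is
      the sign character, injectivity of \<open>S\<close> on \<open>X \<union> Y\<close> forces
      \<open>\<sigma>\<close> to be \<open>\<rho> \<circ> \<rho>'\<close> itself.\<close>
    have "chi b \<sigma> = chi b (\<rho> \<circ> \<rho>')"
    proof (cases b)
      case True
      have \<rho>'': "(\<rho> \<circ> \<rho>') permutes X \<union> Y"
        using \<rho> by (intro permutes_compose) (auto intro: permutes_subset)
      have "\<sigma> x = (\<rho> \<circ> \<rho>') x" for x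
      proof (cases "x \<in> X \<union> Y")
        case x: True
        then have "\<sigma> x \<in> X \<union> Y" "(\<rho> \<circ> \<rho>') x \<in> X \<union> Y"
          by (simp_all only: permutes_in_image[OF s] permutes_in_image[OF \<rho>''])
        then show ?thesis using inj_onD[OF inj[OF True]] fun_cong[OF eq', of x] by simp
      next
        case False
        then show ?thesis using permutes_not_in[OF s] permutes_not_in[OF \<rho>''] by metis
      qed
      then show ?thesis by (metis ext)
    qed (simp add: chi_def)
    then have "of_int (chi b \<sigma>) * F (S \<circ> \<sigma>) =
        of_int (chi b (\<rho> \<circ> \<rho>') * chi b (\<rho> \<circ> \<rho>')) * F S"
      unfolding eq' equiv[OF \<rho>] by (simp add: mult.assoc)
    then show ?thesis by (simp add: chi_square)
  qed
  have "0 = (\<Sum>\<sigma>\<in>E. of_int (chi b \<sigma>) * F (S \<circ> \<sigma>)) + (\<Sum>\<sigma>\<in>G - E. of_int (chi b \<sigma>) * F (S \<circ> \<sigma>))"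
    using rel by (simp add: G_def[symmetric] sum.subset_diff[OF EG finG] add.commute)
  also have "(\<Sum>\<sigma>\<in>E. of_int (chi b \<sigma>) * F (S \<circ> \<sigma>)) = of_nat (card E) * F S"
    by (simp add: E)
  finally have "0 = of_nat (card E) * F S + (\<Sum>\<sigma>\<in>G - E. of_int (chi b \<sigma>) * F (S \<circ> \<sigma>))" .
  from this[symmetric]
  have "of_nat (card E) * F S = - (\<Sum>\<sigma>\<in>G - E. of_int (chi b \<sigma>) * F (S \<circ> \<sigma>))"
    by (simp only: eq_neg_iff_add_eq_0)
  moreover have "F (S \<circ> \<sigma>) \<in> ?W" if "\<sigma> \<in> G - E" for \<sigma>
  proof -
    have s: "\<sigma> permutes X \<union> Y" using that by (simp add: G_def)
    have "(\<Sum>y\<in>Y. S y) < (\<Sum>y\<in>Y. S (\<sigma> y))"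
      using sum_over_exchange(1)[of X Y \<sigma> v S, OF fin disj s vX vY] that by (auto simp: E_def)
    then show ?thesis using s by blast
  qed
  ultimately have "of_nat (card E) * F S \<in> lp.span ?W"
    by (auto intro!: lp.span_neg lp.span_sum lp_span_of_int intro: lp.span_base)
  \<comment> \<open>The identity contributes one term of this kind, so the multiplicity is
    nonzero.\<close>
  moreover have "id \<in> E" by (auto simp: E_def G_def permutes_id)
  then have "card E > 0" using finite_subset[OF EG finG] by (auto simp: card_gt_0_iff)
  ultimately show ?thesis by (rule lp_span_of_nat_cancel)
qed

subsection \<open>Garnir relations\<close>

text \<open>With \<open>b = True\<close> this is the antisymmetrization over the rows followed by the symmetrization
  over the columns; \<open>b = False\<close> interchanges the two characters, and is used with \<open>ri\<close> and \<open>ci\<close>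
  interchanged as well.\<close>

definition symmetrized :: "'a set \<Rightarrow> ('a \<Rightarrow> nat) \<Rightarrow> ('a \<Rightarrow> nat) \<Rightarrow> bool \<Rightarrow>
    (('a \<Rightarrow> nat) \<Rightarrow> lpoly) \<Rightarrow> ('a \<Rightarrow> nat) \<Rightarrow> lpoly" where
  "symmetrized C ri ci b \<Theta> S =
    (\<Sum>q\<in>fiber_perms C ri. \<Sum>p\<in>fiber_perms C ci.
       of_int (chi b q * chi (\<not> b) p) * \<Theta> (S \<circ> q \<circ> p))"

text \<open>The substitution of \<open>k \<circ> q\<close> for \<open>q\<close> absorbs
  \<open>k\<close> at the cost of \<open>chi b k\<close>. In the straightening this sorts the rows
  and, for the sign character, kills fillings with a repetition in a row.\<close>

lemma symmetrized_compose_row: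
  fixes C :: "'a set"
  assumes "finite C" "k \<in> fiber_perms C ri"
  shows "symmetrized C ri ci b \<Theta> (S \<circ> k) = of_int (chi b k) * symmetrized C ri ci b \<Theta> S"
proof -
  have "symmetrized C ri ci b \<Theta> (S \<circ> k) =
    (\<Sum>q\<in>fiber_perms C ri. \<Sum>p\<in>fiber_perms C ci.
       of_int (chi b k) * (of_int (chi b (k \<circ> q) * chi (\<not> b) p) * \<Theta> (S \<circ> (k \<circ> q) \<circ> p)))"
    unfolding symmetrized_def
  proof (intro sum.cong refl)
    fix q p :: "'a \<Rightarrow> 'a" assume "q \<in> fiber_perms C ri"
    then have "chi b (k \<circ> q) = chi b k * chi b q"
      using assms fiber_permsD(1) by (intro chi_compose) auto
    then have "chi b q * chi (\<not> b) p = chi b k * (chi b (k \<circ> q) * chi (\<not> b) p)"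
      by (simp add: mult.assoc[symmetric] chi_square)
    then show "of_int (chi b q * chi (\<not> b) p) * \<Theta> (S \<circ> k \<circ> q \<circ> p) =
      of_int (chi b k) * (of_int (chi b (k \<circ> q) * chi (\<not> b) p) * \<Theta> (S \<circ> (k \<circ> q) \<circ> p))"
      by (simp only: of_int_mult mult.assoc comp_assoc)
  qed
  also have "\<dots> = of_int (chi b k) * symmetrized C ri ci b \<Theta> S"
    unfolding symmetrized_def sum_distrib_left
    by (rule sum_fiber_perms_compose_left[OF assms(2)])
  finally show ?thesis .
qed

text \<open>The sum vanishes already for each fixed row permutation \<open>q\<close>. Two cells of
  one column that \<open>q\<close> sends into \<open>Z\<close> give a transposition
  \<open>\<tau>\<close> of \<open>Z\<close> with
  \<open>\<tau> \<circ> q = q \<circ> \<kappa>\<close> for a column transposition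
  \<open>\<kappa>\<close>. Exactly one of the two is weighted by the sign character, so absorbing
  \<open>\<tau>\<close> into \<open>\<sigma>\<close> and \<open>\<kappa>\<close> into
  \<open>p\<close> shows that the sum is its own negative.\<close>

lemma garnir_relation:
  assumes "finite C" "Z \<subseteq> C"
    and pig: "\<And>q. q \<in> fiber_perms C ri \<Longrightarrow>
      \<exists>k\<in>C. \<exists>k'\<in>C. k \<noteq> k' \<and> ci k = ci k' \<and> q k \<in> Z \<and> q k' \<in> Z"
  shows "(\<Sum>\<sigma> | \<sigma> permutes Z. of_int (chi b \<sigma>) * symmetrized C ri ci b \<Theta> (S \<circ> \<sigma>)) = 0"
proof -
  define P where "P = fiber_perms Z (\<lambda>_. ())"
  have P: "{\<sigma>. \<sigma> permutes Z} = P" by (auto simp: P_def fiber_perms_def)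
  have finZ: "finite Z" using assms(1,2) by (rule finite_subset[rotated])
  define f where "f \<sigma> q p = (of_int (chi b \<sigma> * chi (\<not> b) p) * \<Theta> (S \<circ> \<sigma> \<circ> q \<circ> p))" for \<sigma> q p
  have zero: "(\<Sum>\<sigma>\<in>P. \<Sum>p\<in>fiber_perms C ci. f \<sigma> q p) = 0" (is "?L = 0")
    if q: "q \<in> fiber_perms C ri" for q
  proof -
    obtain k k' where k: "k \<in> C" "k' \<in> C" "k \<noteq> k'" "ci k = ci k'" "q k \<in> Z" "q k' \<in> Z"
      using pig[OF q] by auto
    define \<tau> where "\<tau> = Transposition.transpose (q k) (q k')"
    define \<kappa> where "\<kappa> = Transposition.transpose k k'"
    have injq: "inj q" using permutes_inj[OF fiber_permsD(1)[OF q]] .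
    have \<tau>q: "\<tau> \<circ> q = q \<circ> \<kappa>"
      unfolding \<tau>_def \<kappa>_def using injq by (auto simp: fun_eq_iff Transposition.transpose_def dest: injD)
    have \<tau>: "\<tau> \<in> P" unfolding \<tau>_def P_def using k by (intro fiber_perms_transpose) auto
    have \<kappa>: "\<kappa> \<in> fiber_perms C ci" unfolding \<kappa>_def using k by (intro fiber_perms_transpose) auto
    have sgn: "chi b \<tau> * chi (\<not> b) \<kappa> = -1"
      using k(3) injq by (auto simp: \<tau>_def \<kappa>_def chi_transpose inj_eq)
    have "f (\<sigma> \<circ> \<tau>) q p = - f \<sigma> q (\<kappa> \<circ> p)" if "\<sigma> \<in> P" "p \<in> fiber_perms C ci" for \<sigma> p
    proof -
      have "chi b (\<sigma> \<circ> \<tau>) = chi b \<sigma> * chi b \<tau>"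
        using chi_compose[OF finZ] that(1) \<tau> by (auto simp: P[symmetric])
      moreover have "chi (\<not> b) (\<kappa> \<circ> p) = chi (\<not> b) \<kappa> * chi (\<not> b) p"
        using chi_compose[OF assms(1) fiber_permsD(1)[OF \<kappa>] fiber_permsD(1)[OF that(2)]] .
      moreover have "chi b \<tau> = - chi (\<not> b) \<kappa>"
        using sgn by (auto simp: chi_def sign_def split: if_splits)
      ultimately have "chi b (\<sigma> \<circ> \<tau>) * chi (\<not> b) p = - (chi b \<sigma> * chi (\<not> b) (\<kappa> \<circ> p))" by simp
      moreover have "S \<circ> (\<sigma> \<circ> \<tau>) \<circ> q \<circ> p = S \<circ> \<sigma> \<circ> q \<circ> (\<kappa> \<circ> p)"
        using \<tau>q by (metis comp_assoc)
      ultimately show ?thesis by (simp only: f_def of_int_minus mult_minus_left)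
    qed
    then have "(\<Sum>\<sigma>\<in>P. \<Sum>p\<in>fiber_perms C ci. f (\<sigma> \<circ> \<tau>) q p) =
        (\<Sum>\<sigma>\<in>P. \<Sum>p\<in>fiber_perms C ci. - f \<sigma> q (\<kappa> \<circ> p))"
      by (intro sum.cong refl)
    also have "\<dots> = - ?L"
      by (simp only: sum_negf sum_fiber_perms_compose_left[OF \<kappa>, of "f _ q"])
    also have "(\<Sum>\<sigma>\<in>P. \<Sum>p\<in>fiber_perms C ci. f (\<sigma> \<circ> \<tau>) q p) = ?L"
      using sum_fiber_perms_compose_right[OF \<tau>[unfolded P_def], of "\<lambda>\<sigma>. \<Sum>p\<in>fiber_perms C ci. f \<sigma> q p"]
      unfolding P_def .
    finally show ?thesis by (rule lp_eq_minus_self_imp_zero)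
  qed
  have "(\<Sum>\<sigma>\<in>P. of_int (chi b \<sigma>) * symmetrized C ri ci b \<Theta> (S \<circ> \<sigma>)) =
    (\<Sum>\<sigma>\<in>P. \<Sum>q\<in>fiber_perms C ri. of_int (chi b q) * (\<Sum>p\<in>fiber_perms C ci. f \<sigma> q p))"
    by (simp add: symmetrized_def f_def sum_distrib_left mult_ac comp_assoc)
  also have "\<dots> = (\<Sum>q\<in>fiber_perms C ri. of_int (chi b q) * (\<Sum>\<sigma>\<in>P. \<Sum>p\<in>fiber_perms C ci. f \<sigma> q p))"
    unfolding sum_distrib_left by (rule sum.swap)
  also have "\<dots> = 0" by (simp add: zero)
  finally show ?thesis by (simp add: P)
qed

section \<open>Diagrams with exchangeable rows and columns\<close>

text \<open>Row and column numbers are parameters on an abstract set of cells, so that exchanging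
  them yields another instance and every result applies to the transposed diagram.\<close>

locale diagram =
  fixes C :: "'a set" and ri ci :: "'a \<Rightarrow> nat"
  assumes finite_cells: "finite C"
    and cell_eqI: "\<And>x y. x \<in> C \<Longrightarrow> y \<in> C \<Longrightarrow> ri x = ri y \<Longrightarrow> ci x = ci y \<Longrightarrow> x = y"
    and down_closed: "\<And>x r c. x \<in> C \<Longrightarrow> r \<le> ri x \<Longrightarrow> c \<le> ci x \<Longrightarrow> \<exists>y\<in>C. ri y = r \<and> ci y = c"
begin

lemma transposed: "diagram C ci ri"
proof
  fix x r c assume "x \<in> C" "r \<le> ci x" "c \<le> ri x"
  then show "\<exists>y\<in>C. ci y = r \<and> ri y = c" using down_closed[of x c r] by blast
qed (use finite_cells cell_eqI in auto)

text \<open>Exchanging \<open>ri\<close> with \<open>ci\<close> and negating \<open>b\<close>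
  describes the same fillings. Cells of one row are compared in all pairs, as sorting can treat any
  pair; cells of one column only when adjacent, as a Garnir exchange involves neighbouring
  rows.\<close>

definition semistandard :: "bool \<Rightarrow> ('a \<Rightarrow> nat) \<Rightarrow> bool" where
  "semistandard b S \<longleftrightarrow>
    (\<forall>x\<in>C. \<forall>y\<in>C. ri x = ri y \<longrightarrow> ci x < ci y \<longrightarrow> (if b then S x < S y else S x \<le> S y)) \<and>
    (\<forall>x\<in>C. \<forall>y\<in>C. ci x = ci y \<longrightarrow> ri y = Suc (ri x) \<longrightarrow> (if b then S x \<le> S y else S x < S y))"

text \<open>\<open>X\<close> is the end of a row from \<open>x\<close> on and \<open>Y\<close> the
  start of the next row up to \<open>y\<close>. Their columns cover those of the upper row, and the
  column of \<open>x\<close> is counted twice, so \<open>X \<union> Y\<close> has more cells than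
  the upper row has columns. A row permutation keeps the cells in these two rows, where no column
  outside the upper row occurs, so two preimages under \<open>q\<close> share a column.\<close>

lemma garnir_pigeonhole:
  assumes x: "x \<in> C" and y: "y \<in> C" and xy: "ci x = ci y" "ri y = Suc (ri x)"
    and q: "q \<in> fiber_perms C ri"
  defines "X \<equiv> {z\<in>C. ri z = ri x \<and> ci x \<le> ci z}"
    and "Y \<equiv> {z\<in>C. ri z = ri y \<and> ci z \<le> ci x}"
  shows "\<exists>k\<in>C. \<exists>k'\<in>C. k \<noteq> k' \<and> ci k = ci k' \<and> q k \<in> X \<union> Y \<and> q k' \<in> X \<union> Y"
proof -
  define R where "R = {z\<in>C. ri z = ri x}"
  have fin: "finite X" "finite Y" "finite R" using finite_cells by (auto simp: X_def Y_def R_def)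
  have XY: "X \<inter> Y = {}" using xy(2) by (auto simp: X_def Y_def)
  have injX: "inj_on ci X" and injY: "inj_on ci Y" and injR: "inj_on ci R"
    by (auto simp: X_def Y_def R_def intro!: inj_onI cell_eqI)
  have sub: "ci ` R \<subseteq> ci ` X \<union> ci ` Y"
  proof
    fix c assume "c \<in> ci ` R"
    then obtain z where z: "z \<in> C" "ri z = ri x" "c = ci z" by (auto simp: R_def)
    show "c \<in> ci ` X \<union> ci ` Y"
    proof (cases "ci x \<le> ci z")
      case True
      then have "z \<in> X" using z by (simp add: X_def)
      then show ?thesis using z(3) by blast
    next
      case False
      \<comment> \<open>Left of \<open>x\<close> there is a cell in the row of \<open>y\<close> as
        well, because that row reaches as far as \<open>y\<close>.\<close>
      then obtain w where "w \<in> C" "ri w = ri y" "ci w = ci z"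
        using down_closed[OF y, of "ri y" "ci z"] xy(1) by auto
      then have "w \<in> Y" "ci w = c" using False z(3) by (auto simp: Y_def)
      then show ?thesis by blast
    qed
  qed
  have "x \<in> X" "y \<in> Y" using x y xy(1) by (auto simp: X_def Y_def)
  then have "ci x \<in> ci ` X \<inter> ci ` Y" using xy(1) by (metis IntI imageI)
  then have "card (ci ` X \<inter> ci ` Y) > 0" using fin by (auto simp: card_gt_0_iff)
  then have "card (ci ` R) < card (ci ` X) + card (ci ` Y)"
    using card_Un_Int[of "ci ` X" "ci ` Y"] card_mono[OF _ sub] fin by simp
  then have less: "card (ci ` R) < card (X \<union> Y)"
    using fin XY by (simp add: card_Un_disjoint card_image injX injY)
  note p = fiber_permsD[OF fiber_perms_inv[OF q]]
  have XYC: "X \<union> Y \<subseteq> C" by (auto simp: X_def Y_def)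
  have colR: "(ci \<circ> pinv q) ` (X \<union> Y) \<subseteq> ci ` R"
  proof
    fix c assume "c \<in> (ci \<circ> pinv q) ` (X \<union> Y)"
    then obtain z where z: "z \<in> X \<union> Y" "c = ci (pinv q z)" by auto
    then have "pinv q z \<in> C" "ri (pinv q z) = ri z"
      using XYC p permutes_in_image[OF p(1)] by auto
    moreover have "ri x \<le> ri z" using z(1) xy(2) by (auto simp: X_def Y_def)
    ultimately obtain w where "w \<in> C" "ri w = ri x" "ci w = c"
      using down_closed[of "pinv q z" "ri x" c] z(2) by auto
    then show "c \<in> ci ` R" by (auto simp: R_def)
  qed
  then have "card ((ci \<circ> pinv q) ` (X \<union> Y)) < card (X \<union> Y)"
    using less card_mono[OF _ colR] fin by simp
  then have "\<not> inj_on (ci \<circ> pinv q) (X \<union> Y)" by (rule pigeonhole)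
  then obtain u v where uv: "u \<in> X \<union> Y" "v \<in> X \<union> Y" "u \<noteq> v" "ci (pinv q u) = ci (pinv q v)"
    by (auto simp: inj_on_def)
  have qq: "q (pinv q z) = z" for z using permutes_inverses(1)[OF fiber_permsD(1)[OF q]] .
  show ?thesis
  proof (intro bexI conjI)
    show "pinv q u \<noteq> pinv q v" using uv(3) qq by metis
    show "pinv q u \<in> C" "pinv q v \<in> C" using uv(1,2) XYC permutes_in_image[OF p(1)] by auto
  qed (use uv qq in auto)
qed

end

subsection \<open>Straightening\<close>

text \<open>The rearrangement inequality for a single inversion.\<close>

lemma sum_transpose_less:
  fixes w S :: "'a \<Rightarrow> nat"
  assumes "finite C" "x \<in> C" "y \<in> C" "w x < w y" "S y < S x"
  shows "(\<Sum>z\<in>C. w z * S z) < (\<Sum>z\<in>C. w z * S (Transposition.transpose x y z))"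
proof -
  define D where "D = C - {x, y}"
  have C: "C = insert x (insert y D)" and D: "x \<notin> D" "y \<notin> D" "finite D" "x \<noteq> y"
    using assms by (auto simp: D_def)
  have rest: "(\<Sum>z\<in>D. w z * S (Transposition.transpose x y z)) = (\<Sum>z\<in>D. w z * S z)"
    using D by (intro sum.cong) (auto simp: Transposition.transpose_def)
  obtain k l where k: "w y = w x + k" "k > 0" and l: "S x = S y + l" "l > 0"
    using assms(4,5) less_imp_add_positive by metis
  have "w x * S x + w y * S y < w x * S y + w y * S x"
    unfolding k(1) l(1) using k(2) l(2) by (simp add: algebra_simps)
  then show ?thesis unfolding C using D by (simp add: rest)
qed

context diagram
begin

text \<open>Well-founded induction on how far the weights \<open>wr\<close> and \<open>wc\<close>
  lie below their bounds, compared lexicographically. Sorting a row keeps \<open>wr\<close> and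
  raises \<open>wc\<close>; a Garnir exchange raises \<open>wr\<close>, whatever happens to
  \<open>wc\<close>. All fillings that arise are rearrangements of \<open>S\<close>, so the bound
  \<open>N\<close> and the set of entries persist.\<close>

lemma symmetrized_in_span_semistandard:
  assumes "\<And>x. x \<in> C \<Longrightarrow> S x \<le> N"
  shows "symmetrized C ri ci b \<Theta> S \<in>
    lp.span {symmetrized C ri ci b \<Theta> U | U. U ` C \<subseteq> S ` C \<and> semistandard b U}"
proof -
  let ?F = "symmetrized C ri ci b \<Theta>"
  let ?W = "\<lambda>S. {?F U | U. U ` C \<subseteq> S ` C \<and> semistandard b U}"
  define wr wc where "wr S = (\<Sum>z\<in>C. ri z * S z)" and "wc S = (\<Sum>z\<in>C. ci z * S z)" for S :: "'a \<Rightarrow> nat"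
  \<comment> \<open>Upper bounds for the weights of fillings with entries at most \<open>N\<close>;
    subtracting from them turns growing weights into decreasing natural numbers.\<close>
  define Br Bc where "Br = (\<Sum>z\<in>C. ri z * N)" and "Bc = (\<Sum>z\<in>C. ci z * N)"
  define M :: "(('a \<Rightarrow> nat) \<times> ('a \<Rightarrow> nat)) set" where
    "M = measures [\<lambda>S. Br - wr S, \<lambda>S. Bc - wc S]"
  have wr_le: "wr S \<le> Br" and wc_le: "wc S \<le> Bc" if "\<And>x. x \<in> C \<Longrightarrow> S x \<le> N" for S
    using that by (auto simp: wr_def wc_def Br_def Bc_def intro!: sum_mono)
  have "wf M" by (simp add: M_def)
  then show ?thesis using assms
  proof (induction S rule: wf_induct_rule)
    case (less S)
    have bound: "\<And>x. x \<in> C \<Longrightarrow> S (\<sigma> x) \<le> N" if "\<sigma> permutes C" for \<sigma>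
      using less.prems permutes_in_image[OF that] by auto
    have img: "(S \<circ> \<sigma>) ` C = S ` C" if "\<sigma> permutes C" for \<sigma>
      using permutes_image[OF that] by (metis image_comp)
    have IH: "?F (S \<circ> \<sigma>) \<in> lp.span (?W S)" if "\<sigma> permutes C" "(S \<circ> \<sigma>, S) \<in> M" for \<sigma>
    proof -
      have "\<And>x. x \<in> C \<Longrightarrow> (S \<circ> \<sigma>) x \<le> N" using bound[OF that(1)] by simp
      from less.IH[OF that(2) this] show ?thesis by (simp only: img[OF that(1)])
    qed
    \<comment> \<open>Rows are sorted and repetitions in a row removed first, since the Garnir
      exchange relies on monotone rows and, for the sign character, on distinct entries.\<close>
    consider
        (unsorted) x y where "x \<in> C" "y \<in> C" "ri x = ri y" "ci x < ci y" "S y < S x"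
      | (repeated) x y where "b" "x \<in> C" "y \<in> C" "ri x = ri y" "x \<noteq> y" "S x = S y"
      | (violation) x y where "x \<in> C" "y \<in> C" "ci x = ci y" "ri y = Suc (ri x)"
          "if b then S y < S x else S y \<le> S x"
          "\<And>x y. x \<in> C \<Longrightarrow> y \<in> C \<Longrightarrow> ri x = ri y \<Longrightarrow> ci x < ci y \<Longrightarrow> S x \<le> S y"
          "\<And>x y. b \<Longrightarrow> x \<in> C \<Longrightarrow> y \<in> C \<Longrightarrow> ri x = ri y \<Longrightarrow> S x = S y \<Longrightarrow> x = y"
      | (std) "semistandard b S"
    proof (cases "\<exists>x\<in>C. \<exists>y\<in>C. ri x = ri y \<and> ci x < ci y \<and> S y < S x")
      case True
      then show ?thesis using unsorted by blast
    next
      case sorted: False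
      show ?thesis
      proof (cases "b \<and> (\<exists>x\<in>C. \<exists>y\<in>C. ri x = ri y \<and> x \<noteq> y \<and> S x = S y)")
        case True
        then show ?thesis using repeated by blast
      next
        case distinct: False
        have le: "S x \<le> S y" if "x \<in> C" "y \<in> C" "ri x = ri y" "ci x < ci y" for x y
          using sorted that by (meson linorder_not_less)
        have eq: "x = y" if "b" "x \<in> C" "y \<in> C" "ri x = ri y" "S x = S y" for x y
          using distinct that by blast
        show ?thesis
        proof (cases "semistandard b S")
          case True
          then show ?thesis by (rule std)
        next
          case False
          have "if b then S x < S y else S x \<le> S y"
            if "x \<in> C" "y \<in> C" "ri x = ri y" "ci x < ci y" for x y
            using le[OF that] eq[OF _ that(1-3)] that(4) by (auto simp: less_le)
          then obtain x y where "x \<in> C" "y \<in> C" "ci x = ci y" "ri y = Suc (ri x)"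
              "\<not> (if b then S x \<le> S y else S x < S y)"
            using False unfolding semistandard_def by blast
          then show ?thesis using le eq by (intro violation) (auto split: if_splits)
        qed
      qed
    qed
    then show ?case
    proof cases
      case unsorted
      define \<tau> where "\<tau> = Transposition.transpose x y"
      have \<tau>: "\<tau> \<in> fiber_perms C ri"
        unfolding \<tau>_def using unsorted by (intro fiber_perms_transpose)
      note \<tau>' = fiber_permsD[OF \<tau>]
      have "wr (S \<circ> \<tau>) = (\<Sum>z\<in>C. ri (\<tau> z) * S (\<tau> z))"
        unfolding wr_def by (intro sum.cong) (simp_all add: \<tau>'(2))
      also have "\<dots> = wr S"
        unfolding wr_def using sum.permute[OF \<tau>'(1), of "\<lambda>z. ri z * S z"] by (simp add: o_def)
      finally have "wr (S \<circ> \<tau>) = wr S" .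
      moreover have "wc S < wc (S \<circ> \<tau>)"
        using sum_transpose_less[OF finite_cells unsorted(1,2), of ci S] unsorted
        by (simp add: wc_def \<tau>_def)
      moreover have "wc (S \<circ> \<tau>) \<le> Bc" using bound[OF \<tau>'(1)] by (intro wc_le) simp
      ultimately have "(S \<circ> \<tau>, S) \<in> M" by (simp add: M_def)
      then have "of_int (chi b \<tau>) * ?F (S \<circ> \<tau>) \<in> lp.span (?W S)"
        by (intro lp_span_of_int IH \<tau>')
      also have "of_int (chi b \<tau>) * ?F (S \<circ> \<tau>) = of_int (chi b \<tau> * chi b \<tau>) * ?F S"
        by (simp only: symmetrized_compose_row[OF finite_cells \<tau>] of_int_mult mult.assoc)
      finally show ?thesis by (simp add: chi_square)
    next
      case repeated
      define \<tau> where "\<tau> = Transposition.transpose x y"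
      have \<tau>: "\<tau> \<in> fiber_perms C ri"
        unfolding \<tau>_def using repeated by (intro fiber_perms_transpose)
      have "S \<circ> \<tau> = S" using repeated by (auto simp: \<tau>_def fun_eq_iff Transposition.transpose_def)
      then have "?F S = - ?F S"
        using symmetrized_compose_row[OF finite_cells \<tau>, of ci b \<Theta> S] repeated
        by (simp add: \<tau>_def chi_transpose)
      from lp_eq_minus_self_imp_zero[OF this] show ?thesis by (simp only: lp.span_zero)
    next
      case violation
      \<comment> \<open>The threshold between the two sets is \<open>S x\<close>: monotone rows
        bound the entries on \<open>X\<close> from below by \<open>S x\<close>, and those on
        \<open>Y\<close> from above by \<open>S y \<le> S x\<close>.\<close>
      define X Y where "X = {z\<in>C. ri z = ri x \<and> ci x \<le> ci z}"
        and "Y = {z\<in>C. ri z = ri y \<and> ci z \<le> ci x}"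
      have fin: "finite X" "finite Y" using finite_cells by (auto simp: X_def Y_def)
      have XYC: "X \<union> Y \<subseteq> C" and disj: "X \<inter> Y = {}" using violation(4) by (auto simp: X_def Y_def)
      have le: "S u \<le> S v" if "u \<in> C" "v \<in> C" "ri u = ri v" "ci u \<le> ci v" for u v
        using violation(6)[OF that(1-3)] cell_eqI[OF that(1-3)] that(4) by (cases "ci u = ci v") auto
      have vX: "S x \<le> S z" if "z \<in> X" for z
        using that violation(1) by (intro le) (auto simp: X_def)
      have vY': "S z \<le> S y" if "z \<in> Y" for z
        using that violation(2,3) by (intro le) (auto simp: Y_def)
      have yx: "S y \<le> S x" using violation(5) by (auto split: if_splits)
      have vY: "S z \<le> S x" if "z \<in> Y" for z
        using vY'[OF that] yx by simp
      \<comment> \<open>For the sign character the violation is strict, so no entry on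
        \<open>X\<close> equals one on \<open>Y\<close>, and entries within one row are
        distinct.\<close>
      have inj: "inj_on S (X \<union> Y)" if b
      proof (rule inj_onI)
        fix u v assume uv: "u \<in> X \<union> Y" "v \<in> X \<union> Y" "S u = S v"
        have yx': "S y < S x" using violation(5) that by simp
        have ne: "S s \<noteq> S t" if "s \<in> X" "t \<in> Y" for s t
          using vX[OF that(1)] vY'[OF that(2)] yx' by simp
        have "ri u = ri v" using uv ne[of u v] ne[of v u] by (auto simp: X_def Y_def)
        then show "u = v" using violation(7)[OF that] uv XYC by blast
      qed
      have "?F S \<in> lp.span {?F (S \<circ> \<sigma>) | \<sigma>. \<sigma> permutes X \<union> Y \<and> (\<Sum>y\<in>Y. S y) < (\<Sum>y\<in>Y. S (\<sigma> y))}"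
      proof (rule garnir_step[OF fin disj _ _ vX vY inj])
        fix \<rho> \<rho>' assume "\<rho> permutes X" "\<rho>' permutes Y"
        then have "\<rho> \<circ> \<rho>' \<in> fiber_perms C ri"
          using XYC by (intro fiber_perms_compose fiber_perms_of_subset) (auto simp: X_def Y_def)
        then show "?F (S \<circ> (\<rho> \<circ> \<rho>')) = of_int (chi b (\<rho> \<circ> \<rho>')) * ?F S"
          by (rule symmetrized_compose_row[OF finite_cells])
      next
        show "(\<Sum>\<sigma> | \<sigma> permutes X \<union> Y. of_int (chi b \<sigma>) * ?F (S \<circ> \<sigma>)) = 0"
          using garnir_pigeonhole[OF violation(1-4)]
          by (intro garnir_relation[OF finite_cells XYC]) (simp only: X_def Y_def)
      qed
      moreover have "?F (S \<circ> \<sigma>) \<in> lp.span (?W S)"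
        if s: "\<sigma> permutes X \<union> Y" and less: "(\<Sum>y\<in>Y. S y) < (\<Sum>y\<in>Y. S (\<sigma> y))" for \<sigma>
      proof (rule IH)
        show sC: "\<sigma> permutes C" using permutes_subset[OF s XYC] .
        \<comment> \<open>The row number on \<open>Y\<close> exceeds that on \<open>X\<close> by
          exactly one, so \<open>wr\<close> rises by as much as the sum over
          \<open>Y\<close>.\<close>
        have split: "wr T = (\<Sum>z\<in>C - (X \<union> Y). ri z * T z) + (ri x * (\<Sum>z\<in>X \<union> Y. T z) + (\<Sum>z\<in>Y. T z))" for T
        proof -
          have "(\<Sum>z\<in>X. ri z * T z) = ri x * (\<Sum>z\<in>X. T z)"
            unfolding sum_distrib_left by (intro sum.cong) (auto simp: X_def)
          moreover have "(\<Sum>z\<in>Y. ri z * T z) = Suc (ri x) * (\<Sum>z\<in>Y. T z)"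
            unfolding sum_distrib_left by (intro sum.cong) (auto simp: Y_def violation(4))
          ultimately show ?thesis
            unfolding wr_def sum.subset_diff[OF XYC finite_cells] sum.union_disjoint[OF fin disj]
            by (simp add: algebra_simps)
        qed
        have "(\<Sum>z\<in>C - (X \<union> Y). ri z * (S \<circ> \<sigma>) z) = (\<Sum>z\<in>C - (X \<union> Y). ri z * S z)"
          by (intro sum.cong) (simp_all add: permutes_not_in[OF s])
        moreover have "(\<Sum>z\<in>X \<union> Y. (S \<circ> \<sigma>) z) = (\<Sum>z\<in>X \<union> Y. S z)"
          using sum.permute[OF s, of S] by simp
        ultimately have "wr S < wr (S \<circ> \<sigma>)"
          unfolding split[of S] split[of "S \<circ> \<sigma>"] using less by simp
        moreover have "wr (S \<circ> \<sigma>) \<le> Br" using bound[OF sC] by (intro wr_le) simp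
        ultimately have "Br - wr (S \<circ> \<sigma>) < Br - wr S" by linarith
        then show "(S \<circ> \<sigma>, S) \<in> M" by (simp add: M_def)
      qed
      ultimately show ?thesis by (elim lp_span_trans) blast
    next
      case std
      then show ?thesis by (intro lp.span_base) auto
    qed
  qed
qed

end

subsection \<open>Transporting products over permutations\<close>

text \<open>As \<open>f\<close> takes different values on \<open>A\<close> and on \<open>B\<close>,
  a permutation preserving its fibers maps each of the two sets to itself and is uniquely the
  product of its restrictions. This merges the determinants of separate rows.\<close>

lemma sum_fiber_perms_Un:
  fixes M :: "'a \<Rightarrow> 'a \<Rightarrow> 'c :: comm_ring_1"
  assumes fin: "finite A" "finite B" and disj: "f ` A \<inter> f ` B = {}"
  shows "(\<Sum>q\<in>fiber_perms (A \<union> B) f. of_int (sign q) * (\<Prod>z\<in>A \<union> B. M z (q z))) =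
    (\<Sum>q\<in>fiber_perms A f. of_int (sign q) * (\<Prod>z\<in>A. M z (q z))) *
    (\<Sum>q\<in>fiber_perms B f. of_int (sign q) * (\<Prod>z\<in>B. M z (q z)))"
proof -
  have AB: "A \<inter> B = {}" using disj by auto
  have fix1: "p z = z" if "p \<in> fiber_perms T f" "z \<notin> T" for p z T
    using permutes_not_in[OF fiber_permsD(1)[OF that(1)] that(2)] .
  have mem: "p z \<in> T" if "p \<in> fiber_perms T f" "z \<in> T" for p z T
    using permutes_in_image[OF fiber_permsD(1)[OF that(1)]] that(2) by simp
  have inA: "q z \<in> A" if "q \<in> fiber_perms (A \<union> B) f" "z \<in> A" for q z
    using mem[OF that(1), of z] fiber_permsD(2)[OF that(1), of z] that(2) disj by (auto dest: imageI[of _ _ f])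
  have inB: "q z \<in> B" if "q \<in> fiber_perms (A \<union> B) f" "z \<in> B" for q z
    using mem[OF that(1), of z] fiber_permsD(2)[OF that(1), of z] that(2) disj by (auto dest: imageI[of _ _ f])
  have res: "restrict_id q T \<in> fiber_perms T f"
    if q: "q \<in> fiber_perms (A \<union> B) f" and T: "T \<subseteq> A \<union> B" "finite T" "\<And>z. z \<in> T \<Longrightarrow> q z \<in> T" for q T
  proof -
    have "inj_on q T" using permutes_inj[OF fiber_permsD(1)[OF q]] by (rule inj_on_subset) simp
    moreover from this have "q ` T = T" using T(2,3) by (intro endo_inj_surj) auto
    ultimately have "bij_betw q T T" by (simp add: bij_betw_def)
    then have "restrict_id q T permutes T" by (rule permutes_restrict_id)
    then show ?thesis using fiber_permsD(2)[OF q] T(1) by (auto simp: fiber_perms_def)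
  qed
  have comp: "p \<circ> q \<in> fiber_perms (A \<union> B) f" if "p \<in> fiber_perms A f" "q \<in> fiber_perms B f" for p q
  proof -
    have "(p \<circ> q) permutes A \<union> B"
      using that by (intro permutes_compose) (auto dest!: fiber_permsD(1) intro: permutes_subset)
    moreover have "f ((p \<circ> q) z) = f z" if "z \<in> A \<union> B" for z
    proof (cases "z \<in> A")
      case True
      then have "q z = z" using AB fix1[OF \<open>q \<in> fiber_perms B f\<close>, of z] by auto
      then show ?thesis using True fiber_permsD(2)[OF \<open>p \<in> fiber_perms A f\<close>] by simp
    next
      case False
      then have z: "z \<in> B" using that by simp
      then have "q z \<in> B" using mem[OF \<open>q \<in> fiber_perms B f\<close>] by simp
      then have "p (q z) = q z" using AB fix1[OF \<open>p \<in> fiber_perms A f\<close>, of "q z"] by auto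
      then show ?thesis using z fiber_permsD(2)[OF \<open>q \<in> fiber_perms B f\<close>] by simp
    qed
    ultimately show ?thesis by (simp add: fiber_perms_def)
  qed
  have appA: "(p \<circ> q) z = p z" if "p \<in> fiber_perms A f" "q \<in> fiber_perms B f" "z \<in> A" for p q z
  proof -
    have "z \<notin> B" using that(3) AB by blast
    then show ?thesis using fix1[OF that(2)] by simp
  qed
  have appB: "(p \<circ> q) z = q z" if "p \<in> fiber_perms A f" "q \<in> fiber_perms B f" "z \<in> B" for p q z
  proof -
    have "q z \<notin> A" using mem[OF that(2,3)] AB by blast
    then show ?thesis using fix1[OF that(1)] by simp
  qed
  have "(\<Sum>q\<in>fiber_perms A f. of_int (sign q) * (\<Prod>z\<in>A. M z (q z))) *
      (\<Sum>q\<in>fiber_perms B f. of_int (sign q) * (\<Prod>z\<in>B. M z (q z))) =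
    (\<Sum>(p, q)\<in>fiber_perms A f \<times> fiber_perms B f.
      (of_int (sign p) * (\<Prod>z\<in>A. M z (p z))) * (of_int (sign q) * (\<Prod>z\<in>B. M z (q z))))"
    unfolding sum_product sum.cartesian_product ..
  also have "\<dots> = (\<Sum>q\<in>fiber_perms (A \<union> B) f. of_int (sign q) * (\<Prod>z\<in>A \<union> B. M z (q z)))"
  proof (rule sum.reindex_bij_witness[of _ "\<lambda>q. (restrict_id q A, restrict_id q B)" "\<lambda>(p, q). p \<circ> q"], goal_cases)
    case (1 a)
    then obtain p q where a: "a = (p, q)" and pq: "p \<in> fiber_perms A f" "q \<in> fiber_perms B f" by auto
    have "restrict_id (p \<circ> q) A = p"
      using appA[OF pq] fix1[OF pq(1)] by (intro ext) (metis restrict_id_simps)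
    moreover have "restrict_id (p \<circ> q) B = q"
      using appB[OF pq] fix1[OF pq(2)] by (intro ext) (metis restrict_id_simps)
    ultimately show ?case using a by simp
  next
    case (2 a)
    then show ?case using comp by auto
  next
    case (3 q)
    have "(restrict_id q A \<circ> restrict_id q B) z = q z" for z
      using inA[OF 3] inB[OF 3] AB fix1[OF 3, of z]
      by (cases "z \<in> A"; cases "z \<in> B") (auto simp: restrict_id_def)
    then show ?case by auto
  next
    case (4 q)
    then show ?case using res[OF 4, of A] res[OF 4, of B] inA[OF 4] inB[OF 4] fin by auto
  next
    case (5 a)
    then obtain p q where a: "a = (p, q)" and pq: "p \<in> fiber_perms A f" "q \<in> fiber_perms B f" by auto
    have "sign (p \<circ> q) = sign p * sign q"
      using fiber_permsD(1)[OF pq(1)] fiber_permsD(1)[OF pq(2)] fin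
      by (intro sign_compose permutes_imp_permutation)
    moreover have "(\<Prod>z\<in>A \<union> B. M z ((p \<circ> q) z)) = (\<Prod>z\<in>A. M z (p z)) * (\<Prod>z\<in>B. M z (q z))"
      unfolding prod.union_disjoint[OF fin AB]
      by (intro arg_cong2[of _ _ _ _ "(*)"] prod.cong) (simp_all only: appA[OF pq] appB[OF pq])
    ultimately show ?case unfolding a by (simp add: mult_ac)
  qed
  finally show ?thesis by simp
qed

text \<open>\<open>map_permutation A e\<close> is conjugation by \<open>e\<close>, undone by
  conjugation with the inverse of \<open>e\<close>, and \<open>e\<close> matches the fibers of
  \<open>f\<close> with those of \<open>g\<close>.\<close>

lemma fiber_perms_map_permutation:
  assumes "bij_betw e A B" "\<And>x y. x \<in> A \<Longrightarrow> y \<in> A \<Longrightarrow> g (e x) = g (e y) \<longleftrightarrow> f x = f y"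
  shows "bij_betw (map_permutation A e) (fiber_perms A f) (fiber_perms B g)"
proof (rule bij_betw_byWitness[of _ "map_permutation B (inv_into A e)"])
  have inj: "inj_on e A" and img: "e ` A = B" using assms(1) by (auto simp: bij_betw_def)
  have e': "bij_betw (inv_into A e) B A" using assms(1) by (rule bij_betw_inv_into)
  show "\<forall>p\<in>fiber_perms A f. map_permutation B (inv_into A e) (map_permutation A e p) = p"
    using map_permutation_compose_inv[OF assms(1)] inj by (auto simp: fiber_perms_def)
  show "\<forall>p\<in>fiber_perms B g. map_permutation A e (map_permutation B (inv_into A e) p) = p"
    using map_permutation_compose_inv[OF e'] assms(1)
    by (auto simp: fiber_perms_def bij_betw_inv_into_right)
  show "map_permutation A e ` fiber_perms A f \<subseteq> fiber_perms B g"
  proof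
    fix p' assume "p' \<in> map_permutation A e ` fiber_perms A f"
    then obtain p where p: "p \<in> fiber_perms A f" "p' = map_permutation A e p" by auto
    have "g (p' z) = g z" if z: "z \<in> B" for z
    proof -
      obtain x where x: "x \<in> A" "z = e x" using z img by auto
      have "p x \<in> A" using permutes_in_image[OF fiber_permsD(1)[OF p(1)]] x by simp
      then show ?thesis
        using x fiber_permsD(2)[OF p(1) x(1)] assms(2) by (simp add: p(2) map_permutation_apply[OF inj])
    qed
    then show "p' \<in> fiber_perms B g"
      using map_permutation_permutes[OF assms(1) fiber_permsD(1)[OF p(1)]] p(2) by (auto simp: fiber_perms_def)
  qed
  show "map_permutation B (inv_into A e) ` fiber_perms B g \<subseteq> fiber_perms A f"
  proof
    fix p' assume "p' \<in> map_permutation B (inv_into A e) ` fiber_perms B g"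
    then obtain p where p: "p \<in> fiber_perms B g" "p' = map_permutation B (inv_into A e) p" by auto
    have "f (p' x) = f x" if x: "x \<in> A" for x
    proof -
      have ex: "e x \<in> B" using x img by auto
      have pex: "p (e x) \<in> B" using permutes_in_image[OF fiber_permsD(1)[OF p(1)]] ex by simp
      have p'x: "p' x = inv_into A e (p (e x))"
        using map_permutation_apply[OF bij_betw_imp_inj_on[OF e'] ex, of p] x inj by (simp add: p(2))
      then have "p' x \<in> A" "e (p' x) = p (e x)"
        using pex img by (auto simp: inv_into_into f_inv_into_f)
      then show ?thesis using x fiber_permsD(2)[OF p(1) ex] assms(2) by metis
    qed
    then show "p' \<in> fiber_perms A f"
      using map_permutation_permutes[OF e' fiber_permsD(1)[OF p(1)]] p(2) by (auto simp: fiber_perms_def)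
  qed
qed

subsection \<open>Bitableaux as symmetrized products\<close>

text \<open>Fillings are handled as functions on cells, so that a permutation of the cells acts by
  composition.\<close>

definition tableau_of :: "nat list \<Rightarrow> (nat \<times> nat \<Rightarrow> nat) \<Rightarrow> tableau" where
  "tableau_of lam f = map (\<lambda>r. map (\<lambda>c. f (r, c)) [0..<lam ! r]) [0..<length lam]"

lemma length_tableau_of [simp]: "length (tableau_of lam f) = length lam"
  by (simp add: tableau_of_def)

lemma length_tableau_of_row [simp]: "r < length lam \<Longrightarrow> length (tableau_of lam f ! r) = lam ! r"
  by (simp add: tableau_of_def)

lemma tableau_of_nth [simp]:
  "r < length lam \<Longrightarrow> c < lam ! r \<Longrightarrow> tableau_of lam f ! r ! c = f (r, c)"
  by (simp add: tableau_of_def)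

lemma shape_tableau_of [simp]: "shape (tableau_of lam f) = lam"
  by (simp add: shape_def list_eq_iff_nth_eq)

lemma permute_tableau_of:
  assumes "\<pi> permutes cells lam"
  shows "permute_tableau \<pi> (tableau_of lam f) = tableau_of lam (f \<circ> \<pi>)"
proof -
  have "(case \<pi> (r, c) of (r', c') \<Rightarrow> tableau_of lam f ! r' ! c') = f (\<pi> (r, c))"
    if "r < length lam" "c < lam ! r" for r c
  proof -
    have "\<pi> (r, c) \<in> cells lam" using permutes_in_image[OF assms] that by (simp add: cells_def)
    then show ?thesis by (auto simp: cells_def)
  qed
  then show ?thesis by (simp add: permute_tableau_def) (simp add: tableau_of_def)
qed

lemma finite_cells_partition [simp]: "finite (cells lam)"
proof -
  have "cells lam \<subseteq> (SIGMA r:{..<length lam}. {..<lam ! r})" by (auto simp: cells_def)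
  then show ?thesis by (rule finite_subset) simp
qed

lemma biproduct_eq:
  assumes "length u = m" "length v = m"
  shows "biproduct u v = of_int ((-1) ^ (m choose 2)) *
    (\<Sum>p | p permutes {0..<m}. of_int (sign p) * (\<Prod>i=0..<m. lvar (u ! i) (v ! p i)))"
proof -
  have "det (mat m m (\<lambda>(r, s). lvar (u ! r) (v ! s))) =
    (\<Sum>p | p permutes {0..<m}. of_int (sign p) * (\<Prod>i=0..<m. lvar (u ! i) (v ! p i)))"
    unfolding det_def'[OF mat_carrier]
  proof (intro sum.cong refl arg_cong2[of _ _ _ _ "(*)"] prod.cong)
    fix p i assume "p \<in> {p. p permutes {0..<m}}" "i \<in> {0..<m}"
    then show "mat m m (\<lambda>(r, s). lvar (u ! r) (v ! s)) $$ (i, p i) = lvar (u ! i) (v ! p i)"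
      using permutes_in_image[of p "{0..<m}" i] by simp
  qed
  then show ?thesis using assms by (simp add: biproduct_def)
qed

text \<open>The Leibniz formula for the determinant, with the positions in a row word replaced by
  the cells of that row.\<close>

lemma biproduct_tableau_of:
  assumes "k < length lam"
  defines "R \<equiv> {k} \<times> {..<lam ! k}"
  shows "biproduct (tableau_of lam S ! k) (tableau_of lam T ! k) = of_int ((-1) ^ (lam ! k choose 2)) *
    (\<Sum>q\<in>fiber_perms R fst. of_int (sign q) * (\<Prod>z\<in>R. lvar (S z) (T (q z))))"
proof -
  let ?A = "{0..<lam ! k}"
  have bij: "bij_betw (Pair k) ?A R" by (auto simp: R_def bij_betw_def inj_on_def)
  have inj: "inj_on (Pair k) ?A" by (simp add: inj_on_def)
  have "(\<Sum>q\<in>fiber_perms R fst. of_int (sign q) * (\<Prod>z\<in>R. lvar (S z) (T (q z)))) =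
    (\<Sum>p\<in>fiber_perms ?A (\<lambda>_. ()). of_int (sign (map_permutation ?A (Pair k) p)) *
       (\<Prod>z\<in>R. lvar (S z) (T (map_permutation ?A (Pair k) p z))))"
    by (rule sum.reindex_bij_betw[symmetric], rule fiber_perms_map_permutation[OF bij]) simp
  also have "\<dots> = (\<Sum>p | p permutes ?A. of_int (sign p) *
      (\<Prod>i=0..<lam ! k. lvar (tableau_of lam S ! k ! i) (tableau_of lam T ! k ! p i)))"
  proof (rule sum.cong, goal_cases)
    case 1
    then show ?case by (auto simp: fiber_perms_def)
  next
    case (2 p)
    then have p: "p permutes ?A" by simp
    have "(\<Prod>z\<in>R. lvar (S z) (T (map_permutation ?A (Pair k) p z))) =
        (\<Prod>i\<in>?A. lvar (S (k, i)) (T (map_permutation ?A (Pair k) p (k, i))))"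
      by (rule prod.reindex_bij_betw[OF bij, symmetric])
    also have "\<dots> = (\<Prod>i\<in>?A. lvar (tableau_of lam S ! k ! i) (tableau_of lam T ! k ! p i))"
      using permutes_in_image[OF p] assms(1)
      by (intro prod.cong refl) (simp add: map_permutation_apply[OF inj])
    finally show ?case by (simp add: sign_map_permutation[OF inj p])
  qed
  finally show ?thesis using assms(1) by (simp add: biproduct_eq[of _ "lam ! k"])
qed

text \<open>This collects the sign between the rows of a bitableau and the signs inside the
  biproducts of its rows. Both depend on the shape only.\<close>

definition bitableau_sign :: "nat list \<Rightarrow> int" where
  "bitableau_sign lam = (-1) ^ (\<Sum>k<length lam. lam ! k * (\<Sum>m<k. lam ! m)) *
     (\<Prod>k<length lam. (-1) ^ (lam ! k choose 2))"

lemma bitableau_sign_square: "bitableau_sign lam * bitableau_sign lam = 1"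
proof -
  have 1: "(-1 :: int) ^ m * (-1) ^ m = 1" for m by (simp flip: power_mult_distrib)
  have "bitableau_sign lam * bitableau_sign lam =
    ((-1) ^ (\<Sum>k<length lam. lam ! k * (\<Sum>m<k. lam ! m)) * (-1) ^ (\<Sum>k<length lam. lam ! k * (\<Sum>m<k. lam ! m))) *
    (\<Prod>k<length lam. (-1) ^ (lam ! k choose 2) * (-1) ^ (lam ! k choose 2))"
    unfolding bitableau_sign_def prod.distrib by (simp only: mult_ac)
  also have "\<dots> = 1" unfolding 1 by simp
  finally show ?thesis .
qed

text \<open>Multiplying out the Leibniz formulas of the rows gives one signed sum over the row
  permutations of the whole diagram.\<close>

lemma bitableau_tableau_of:
  "bitableau (tableau_of lam S) (tableau_of lam T) = of_int (bitableau_sign lam) *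
    (\<Sum>q\<in>fiber_perms (cells lam) fst. of_int (sign q) * (\<Prod>z\<in>cells lam. lvar (S z) (T (q z))))"
proof -
  \<comment> \<open>\<open>D m\<close> consists of the first \<open>m\<close> rows, which are merged
    one at a time.\<close>
  define D where "D m = (SIGMA r:{..<m}. {..<lam ! r})" for m
  define f where "f A = (\<Sum>q\<in>fiber_perms A fst. of_int (sign q) * (\<Prod>z\<in>A. lvar (S z) (T (q z))))"
    for A :: "(nat \<times> nat) set"
  have rows: "(\<Prod>k<m. f ({k} \<times> {..<lam ! k})) = f (D m)" for m
  proof (induction m)
    case 0
    have "fiber_perms {} (fst :: nat \<times> nat \<Rightarrow> nat) = {id}" by (auto simp: fiber_perms_def permutes_empty)
    then show ?case by (simp add: D_def f_def)
  next
    case (Suc m)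
    have "D (Suc m) = D m \<union> {m} \<times> {..<lam ! m}" by (auto simp: D_def less_Suc_eq)
    moreover have "f (D m \<union> {m} \<times> {..<lam ! m}) = f (D m) * f ({m} \<times> {..<lam ! m})"
      unfolding f_def by (rule sum_fiber_perms_Un[where M = "\<lambda>z w. lvar (S z) (T w)"]) (auto simp: D_def)
    ultimately show ?case using Suc by simp
  qed
  have cells: "cells lam = D (length lam)" by (auto simp: cells_def D_def)
  have "bitableau (tableau_of lam S) (tableau_of lam T) =
    (-1) ^ (\<Sum>k<length lam. lam ! k * (\<Sum>m<k. lam ! m)) *
    (\<Prod>k<length lam. of_int ((-1) ^ (lam ! k choose 2)) * f ({k} \<times> {..<lam ! k}))"
    unfolding bitableau_def f_def
    by (intro arg_cong2[of _ _ _ _ "(*)"] prod.cong arg_cong[of _ _ "power _"] sum.cong)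
       (simp_all add: biproduct_tableau_of)
  also have "\<dots> = of_int (bitableau_sign lam) * f (cells lam)"
    unfolding cells rows[symmetric] prod.distrib bitableau_sign_def by (simp add: mult.assoc)
  finally show ?thesis unfolding f_def .
qed

section \<open>Right symmetrized bitableaux and their straightening\<close>

text \<open>The right symmetrized bitableau freed from the sign that belongs to its shape.\<close>

definition symsum :: "nat list \<Rightarrow> (nat \<times> nat \<Rightarrow> nat) \<Rightarrow> (nat \<times> nat \<Rightarrow> nat) \<Rightarrow> lpoly" where
  "symsum lam S T = (\<Sum>\<pi>\<in>fiber_perms (cells lam) snd. \<Sum>q\<in>fiber_perms (cells lam) fst.
     of_int (sign q) * (\<Prod>z\<in>cells lam. lvar (S z) (T (\<pi> (q z)))))"

lemma right_sym_bitableau_tableau_of: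
  "right_sym_bitableau (tableau_of lam S) (tableau_of lam T) =
    of_int (bitableau_sign lam) * symsum lam S T"
proof -
  have "column_perms lam = fiber_perms (cells lam) snd"
    by (simp add: column_perms_def fiber_perms_def)
  then show ?thesis
    unfolding right_sym_bitableau_def symsum_def sum_distrib_left[of "of_int (bitableau_sign lam)"]
    by (simp add: permute_tableau_of[OF fiber_permsD(1)] bitableau_tableau_of sum_distrib_left)
qed

lemma symsum_eq_right_sym_bitableau:
  "symsum lam S T =
    of_int (bitableau_sign lam) * right_sym_bitableau (tableau_of lam S) (tableau_of lam T)"
  unfolding right_sym_bitableau_tableau_of mult.assoc[symmetric] of_int_mult[symmetric]
    bitableau_sign_square by simp

lemma symsum_eq_symmetrized_right:
  "symsum lam S T =
    symmetrized (cells lam) snd fst False (\<lambda>T. \<Prod>z\<in>cells lam. lvar (S z) (T z)) T"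
  by (simp add: symsum_def symmetrized_def chi_def)

text \<open>Reindexing the product by \<open>\<pi> \<circ> q\<close> moves the permutations from
  \<open>T\<close> to \<open>S\<close> as inverses. Passing to inverses in both sums preserves the
  groups and the signs, and leaves the row permutation next to \<open>S\<close>, as
  \<open>symmetrized\<close> has it.\<close>

lemma symsum_eq_symmetrized_left:
  "symsum lam S T =
    symmetrized (cells lam) fst snd True (\<lambda>S. \<Prod>z\<in>cells lam. lvar (S z) (T z)) S"
proof -
  let ?R = "fiber_perms (cells lam) fst" and ?K = "fiber_perms (cells lam) snd"
  have "symsum lam S T = (\<Sum>\<pi>\<in>?K. \<Sum>q\<in>?R. of_int (sign (pinv q)) *
    (\<Prod>z\<in>cells lam. lvar (S (pinv q (pinv \<pi> z))) (T z)))"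
    unfolding symsum_def
  proof (intro sum.cong refl arg_cong2[of _ _ _ _ "(*)"])
    fix \<pi> q assume \<pi>: "\<pi> \<in> ?K" and q: "q \<in> ?R"
    note \<pi>' = fiber_permsD(1)[OF \<pi>] and q' = fiber_permsD(1)[OF q]
    show "of_int (sign q) = of_int (sign (pinv q))"
      using sign_inverse[OF permutes_imp_permutation[OF finite_cells_partition q']] by simp
    have "(\<Prod>z\<in>cells lam. lvar (S (pinv q (pinv \<pi> z))) (T z)) =
      (\<Prod>z\<in>cells lam. lvar (S (pinv q (pinv \<pi> (\<pi> (q z))))) (T (\<pi> (q z))))"
      using prod.permute[OF permutes_compose[OF q' \<pi>'], of "\<lambda>z. lvar (S (pinv q (pinv \<pi> z))) (T z)"]
      by (simp add: o_def)
    then show "(\<Prod>z\<in>cells lam. lvar (S z) (T (\<pi> (q z)))) =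
        (\<Prod>z\<in>cells lam. lvar (S (pinv q (pinv \<pi> z))) (T z))"
      by (simp add: permutes_inverses(2)[OF \<pi>'] permutes_inverses(2)[OF q'])
  qed
  also have "\<dots> = (\<Sum>\<pi>\<in>?K. \<Sum>q\<in>?R. of_int (sign q) * (\<Prod>z\<in>cells lam. lvar (S (q (\<pi> z))) (T z)))"
    unfolding sum_fiber_perms_inv[of "\<lambda>q. of_int (sign q) * (\<Prod>z\<in>cells lam. lvar (S (q (pinv _ z))) (T z))"]
    by (rule sum_fiber_perms_inv)
  also have "\<dots> = symmetrized (cells lam) fst snd True (\<lambda>S. \<Prod>z\<in>cells lam. lvar (S z) (T z)) S"
    unfolding symmetrized_def by (subst sum.swap) (simp add: chi_def)
  finally show ?thesis .
qed

lemma diagram_cells: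
  assumes "is_partition lam h"
  shows "diagram (cells lam) fst snd"
proof
  fix x r c assume x: "x \<in> cells lam" and r: "r \<le> fst x" and c: "c \<le> snd x"
  have "lam ! fst x \<le> lam ! r"
    using assms x r sorted_wrt_nth_less[of "(\<ge>)" lam r "fst x"]
    by (cases "r = fst x") (auto simp: is_partition_def cells_def)
  then have "(r, c) \<in> cells lam" using x r c by (auto simp: cells_def)
  then show "\<exists>y\<in>cells lam. fst y = r \<and> snd y = c" by force
qed (auto simp: cells_def intro: finite_cells_partition[unfolded cells_def])

lemma tableau_of_in_standard_tableaux:
  assumes "U ` cells lam \<subseteq> {1..n}"
    and "\<And>r c. (r, Suc c) \<in> cells lam \<Longrightarrow> U (r, c) < U (r, Suc c)"
    and "\<And>r c. (r, c) \<in> cells lam \<Longrightarrow> (Suc r, c) \<in> cells lam \<Longrightarrow> U (r, c) \<le> U (Suc r, c)"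
  shows "tableau_of lam U \<in> standard_tableaux lam n"
proof -
  have "set w \<subseteq> {1..n} \<and> sorted_wrt (<) w" if w: "w \<in> set (tableau_of lam U)" for w
  proof -
    obtain r where r: "r < length lam" "w = map (\<lambda>c. U (r, c)) [0..<lam ! r]"
      using w by (auto simp: tableau_of_def)
    then have "set w \<subseteq> {1..n}" using assms(1) by (force simp: cells_def)
    moreover have "sorted_wrt (<) w"
      using r assms(2)[of r] by (subst sorted_wrt_iff_nth_Suc_transp) (auto simp: cells_def)
    ultimately show ?thesis by simp
  qed
  then show ?thesis
    using assms(3) by (auto simp: standard_tableaux_def standard_def cells_def)
qed

text \<open>The left filling is straightened while the right one is fixed; then the right one is
  straightened for each semistandard left filling, in the transposed diagram with the characters
  exchanged. No new entries appear, so both alphabets are respected.\<close>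

lemma symsum_in_span_standard:
  assumes lam: "is_partition lam h"
    and S: "S ` cells lam \<subseteq> {1..n}" and T: "T ` cells lam \<subseteq> {1..d}"
  shows "symsum lam S T \<in>
    lp.span {right_sym_bitableau U V | U V. U \<in> standard_tableaux lam n \<and> V \<in> standard_tableaux lam d}"
    (is "_ \<in> lp.span ?W")
proof -
  interpret diagram "cells lam" fst snd using lam by (rule diagram_cells)
  interpret tr: diagram "cells lam" snd fst by (rule transposed)
  have cell: "(r, c) \<in> cells lam" if "(r, Suc c) \<in> cells lam" for r c
    using that by (auto simp: cells_def)
  have 1: "symsum lam U T \<in> lp.span ?W"
    if U: "U ` cells lam \<subseteq> S ` cells lam" "semistandard True U" for U
  proof -
    have stU: "tableau_of lam U \<in> standard_tableaux lam n"
      using U S by (intro tableau_of_in_standard_tableaux) (auto simp: semistandard_def cell)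
    have "symsum lam U V \<in> lp.span ?W"
      if V: "V ` cells lam \<subseteq> T ` cells lam" "tr.semistandard False V" for V
    proof -
      have "tableau_of lam V \<in> standard_tableaux lam d"
        using V T by (intro tableau_of_in_standard_tableaux) (auto simp: tr.semistandard_def cell)
      then show ?thesis
        unfolding symsum_eq_right_sym_bitableau using stU
        by (intro lp_span_of_int lp.span_base) blast
    qed
    moreover have "symsum lam U T \<in>
      lp.span {symsum lam U V | V. V ` cells lam \<subseteq> T ` cells lam \<and> tr.semistandard False V}"
      unfolding symsum_eq_symmetrized_right
      using T by (intro tr.symmetrized_in_span_semistandard[where N = d]) auto
    ultimately show ?thesis by (elim lp_span_trans) blast
  qed
  have "symsum lam S T \<in>
      lp.span {symsum lam U T | U. U ` cells lam \<subseteq> S ` cells lam \<and> semistandard True U}"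
    unfolding symsum_eq_symmetrized_left
    using S by (intro symmetrized_in_span_semistandard[where N = n]) auto
  then show ?thesis using 1 by (elim lp_span_trans) blast
qed

subsection \<open>Characters of Specht modules\<close>

lemma less_card_iff_mem:
  fixes A :: "nat set"
  assumes "finite A" and "\<And>x y. x \<in> A \<Longrightarrow> y \<le> x \<Longrightarrow> y \<in> A"
  shows "x < card A \<longleftrightarrow> x \<in> A"
proof (cases "A = {}")
  case False
  have "y \<in> A \<longleftrightarrow> y \<le> Max A" for y
    using assms(2)[OF Max_in[OF assms(1) False], of y] Max_ge[OF assms(1), of y] by blast
  then have A: "A = {..Max A}" by blast
  then have "card A = card {..Max A}" by (rule arg_cong)
  then have "x < card A \<longleftrightarrow> x \<in> {..Max A}" by auto
  with A show ?thesis by blast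
qed simp

lemma less_foldr_max_iff: "c < foldr max xs 0 \<longleftrightarrow> (\<exists>x\<in>set xs. c < x)" for c :: nat
  by (induction xs) (auto simp: less_max_iff_disj)

text \<open>The rows longer than \<open>c\<close> form an initial segment because the parts decrease
  weakly, so row \<open>r\<close> is among them exactly if \<open>r\<close> is less than their
  number.\<close>

lemma cells_conj_partition:
  assumes "is_partition lam h"
  shows "(c, r) \<in> cells (conj_partition lam) \<longleftrightarrow> (r, c) \<in> cells lam"
proof -
  define A where "A = {i. i < length lam \<and> c < lam ! i}"
  have "y \<in> A" if "x \<in> A" "y \<le> x" for x y
    using assms that sorted_wrt_nth_less[of "(\<ge>)" lam y x]
    by (cases "y = x") (auto simp: A_def is_partition_def)
  then have "r < card A \<longleftrightarrow> r \<in> A" by (intro less_card_iff_mem) (simp add: A_def)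
  then have r: "r < length (filter (\<lambda>x. c < x) lam) \<longleftrightarrow> r < length lam \<and> c < lam ! r"
    by (simp add: length_filter_conv_card A_def)
  show ?thesis
  proof (cases "c < foldr max lam 0")
    case True
    then show ?thesis using r by (simp add: cells_def conj_partition_def)
  next
    case False
    then have "\<not> (r < length lam \<and> c < lam ! r)"
      unfolding less_foldr_max_iff using nth_mem by blast
    then show ?thesis using False by (auto simp: cells_def conj_partition_def)
  qed
qed

lemma card_cells: "card (cells lam) = sum_list lam"
proof -
  have "cells lam = (SIGMA r:{..<length lam}. {..<lam ! r})" by (auto simp: cells_def)
  then show ?thesis by (simp add: sum_list_sum_nth atLeast0LessThan)
qed

lemma sum_list_conj_partition:
  assumes "is_partition lam h"
  shows "sum_list (conj_partition lam) = h"
proof -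
  have "bij_betw prod.swap (cells (conj_partition lam)) (cells lam)"
    by (rule bij_betw_byWitness[of _ prod.swap]) (auto simp: cells_conj_partition[OF assms])
  then have "card (cells (conj_partition lam)) = card (cells lam)" by (rule bij_betw_same_card)
  then show ?thesis using assms by (simp add: card_cells is_partition_def)
qed

lemma set_cell_list: "set (cell_list mu) = cells mu"
  by (auto simp: cell_list_def cells_def)

lemma length_cell_list: "length (cell_list mu) = sum_list mu"
proof -
  have "map (length \<circ> (\<lambda>r. map (Pair r) [0..<mu ! r])) [0..<length mu] = map ((!) mu) [0..<length mu]"
    by simp
  then show ?thesis by (simp add: cell_list_def length_concat map_nth)
qed

lemma distinct_cell_list: "distinct (cell_list mu)"
  by (rule card_distinct) (simp add: set_cell_list length_cell_list card_cells)

text \<open>Numbering the cells of the conjugate diagram and transposing turns its row group into the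
  column permutations of the diagram, and its column group into the row permutations.\<close>

definition conj_cell :: "nat list \<Rightarrow> nat \<Rightarrow> nat \<times> nat" where
  "conj_cell lam k = prod.swap (cell_list (conj_partition lam) ! k)"

lemma bij_betw_conj_cell:
  assumes "is_partition lam h"
  shows "bij_betw (conj_cell lam) {..<h} (cells lam)"
proof -
  have "bij_betw ((!) (cell_list (conj_partition lam))) {..<h} (cells (conj_partition lam))"
    using distinct_cell_list
    by (rule bij_betw_nth) (simp_all add: length_cell_list set_cell_list sum_list_conj_partition[OF assms])
  moreover have "bij_betw prod.swap (cells (conj_partition lam)) (cells lam)"
    by (rule bij_betw_byWitness[of _ prod.swap]) (auto simp: cells_conj_partition[OF assms])
  ultimately have "bij_betw (prod.swap \<circ> (!) (cell_list (conj_partition lam))) {..<h} (cells lam)"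
    by (rule bij_betw_trans)
  then show ?thesis by (simp add: conj_cell_def[abs_def] o_def)
qed

text \<open>Relabelling by \<open>conj_cell lam\<close> makes the column group, which carries the
  sign, act along the rows of \<open>lam\<close>, and the row group along its columns. This is why
  the labelling of characters by conjugates fits bitableaux of shape \<open>lam\<close>.\<close>

lemma sum_young_groups_eq_symsum:
  assumes lam: "is_partition lam h"
  defines "e \<equiv> conj_cell lam"
  shows "(\<Sum>r\<in>row_group (conj_partition lam). \<Sum>q\<in>column_group (conj_partition lam).
      of_int (sign q) * (\<Prod>k<h. lvar (a k) (b (r (q k))))) =
    symsum lam (a \<circ> inv_into {..<h} e) (b \<circ> inv_into {..<h} e)"
proof -
  let ?A = "{..<h}" and ?mp = "map_permutation {..<h} e"
  have bij: "bij_betw e ?A (cells lam)" unfolding e_def by (rule bij_betw_conj_cell[OF lam])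
  then have inj: "inj_on e ?A" by (simp add: bij_betw_def)
  have row: "row_group (conj_partition lam) = fiber_perms ?A (\<lambda>k. snd (e k))"
    and col: "column_group (conj_partition lam) = fiber_perms ?A (\<lambda>k. fst (e k))"
    by (auto simp: row_group_def column_group_def fiber_perms_def e_def conj_cell_def
        sum_list_conj_partition[OF lam])
  have bijK: "bij_betw ?mp (fiber_perms ?A (\<lambda>k. snd (e k))) (fiber_perms (cells lam) snd)"
    and bijR: "bij_betw ?mp (fiber_perms ?A (\<lambda>k. fst (e k))) (fiber_perms (cells lam) fst)"
    by (rule fiber_perms_map_permutation[OF bij], rule refl)+
  have "symsum lam (a \<circ> inv_into ?A e) (b \<circ> inv_into ?A e) =
    (\<Sum>r\<in>fiber_perms ?A (\<lambda>k. snd (e k)). \<Sum>q\<in>fiber_perms ?A (\<lambda>k. fst (e k)).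
      of_int (sign (?mp q)) * (\<Prod>z\<in>cells lam. lvar (a (inv_into ?A e z)) (b (inv_into ?A e (?mp r (?mp q z))))))"
    unfolding symsum_def o_apply
    unfolding sum.reindex_bij_betw[OF bijK, symmetric] sum.reindex_bij_betw[OF bijR, symmetric] ..
  also have "\<dots> = (\<Sum>r\<in>fiber_perms ?A (\<lambda>k. snd (e k)). \<Sum>q\<in>fiber_perms ?A (\<lambda>k. fst (e k)).
      of_int (sign q) * (\<Prod>k<h. lvar (a k) (b (r (q k)))))"
  proof (intro sum.cong refl arg_cong2[of _ _ _ _ "(*)"])
    fix r q assume r: "r \<in> fiber_perms ?A (\<lambda>k. snd (e k))" and q: "q \<in> fiber_perms ?A (\<lambda>k. fst (e k))"
    note r' = fiber_permsD(1)[OF r] and q' = fiber_permsD(1)[OF q]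
    show "of_int (sign (?mp q)) = of_int (sign q)" by (simp add: sign_map_permutation[OF inj q'])
    have "inv_into ?A e (e k) = k \<and> inv_into ?A e (?mp r (?mp q (e k))) = r (q k)" if k: "k \<in> ?A" for k
    proof -
      have qk: "q k \<in> ?A" and rqk: "r (q k) \<in> ?A"
        using k permutes_in_image[OF q'] permutes_in_image[OF r'] by simp_all
      show ?thesis
        by (simp add: map_permutation_apply[OF inj k] map_permutation_apply[OF inj qk]
            inv_into_f_f[OF inj k] inv_into_f_f[OF inj rqk])
    qed
    then have "(\<Prod>k\<in>?A. lvar (a (inv_into ?A e (e k))) (b (inv_into ?A e (?mp r (?mp q (e k)))))) =
        (\<Prod>k\<in>?A. lvar (a k) (b (r (q k))))"
      by (intro prod.cong) simp_all
    then show "(\<Prod>z\<in>cells lam. lvar (a (inv_into ?A e z)) (b (inv_into ?A e (?mp r (?mp q z))))) =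
        (\<Prod>k<h. lvar (a k) (b (r (q k))))"
      using prod.reindex_bij_betw[OF bij, of "\<lambda>z. lvar (a (inv_into ?A e z)) (b (inv_into ?A e (?mp r (?mp q z))))"]
      by simp
  qed
  finally show ?thesis unfolding row col by simp
qed

section \<open>The left regular action and the trace\<close>

lemma gleft_add: "gleft s (x + y) = gleft s x + gleft s y"
  by (simp add: gleft_def fun_eq_iff)

lemma gleft_gscale: "gleft s (gscale c x) = gscale c (gleft s x)"
  by (simp add: gleft_def gscale_def)

lemma gleft_zero: "gleft s 0 = 0"
  by (simp add: gleft_def fun_eq_iff)

lemma gleft_sum: "gleft s (sum f A) = (\<Sum>x\<in>A. gleft s (f x))"
  by (induction A rule: infinite_finite_induct)
     (simp_all only: sum.infinite sum.empty sum.insert gleft_zero gleft_add not_False_eq_True)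

lemma gleft_gleft:
  assumes "bij s" "bij t"
  shows "gleft s (gleft t x) = gleft (s \<circ> t) x"
  by (simp add: gleft_def o_inv_distrib[OF assms] comp_assoc)

lemma gleft_specht_module:
  assumes "s permutes {..<sum_list mu}" "x \<in> specht_module mu"
  shows "gleft s x \<in> specht_module mu"
  using assms(2) unfolding specht_module_def
proof (induction rule: galg.span_induct_alt)
  case base
  then show ?case by (simp only: gleft_zero galg.span_zero)
next
  case (step c x y)
  then obtain t where t: "x = gleft t (young_symmetrizer mu)" "t permutes {..<sum_list mu}" by auto
  have "gleft s x = gleft (s \<circ> t) (young_symmetrizer mu)"
    unfolding t(1) by (rule gleft_gleft) (use assms(1) t(2) permutes_bij in blast)+
  then have "gleft s x \<in> galg.span {gleft s (young_symmetrizer mu) | s. s permutes {..<sum_list mu}}"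
    using permutes_compose[OF t(2) assms(1)] by (intro galg.span_base) blast
  then show ?case
    unfolding gleft_add gleft_gscale using step(2) by (intro galg.span_add galg.span_scale)
qed

text \<open>Linearity of \<open>f\<close> expands the Young symmetrizer into group elements. For
  each pair \<open>r\<close>, \<open>q\<close> the sum over \<open>\<sigma>\<close> becomes a sum
  over \<open>p\<close>, the product of \<open>\<sigma>\<close> with
  \<open>t \<circ> (r \<circ> q)\<close>, and the latter factor passes to the second indices of the
  variables.\<close>

lemma sum_functional_young_orbit:
  fixes f :: "galg \<Rightarrow> complex" and i j :: "nat \<Rightarrow> nat"
  assumes f: "Vector_Spaces.linear gscale (*) f"
    and t: "t permutes {..<sum_list mu}"
  shows "(\<Sum>\<sigma> | \<sigma> permutes {..<sum_list mu}. lconst (f (gleft \<sigma> (gleft t (young_symmetrizer mu)))) *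
      (\<Prod>k<sum_list mu. lvar (i (\<sigma> k)) (j k))) =
    (\<Sum>p | p permutes {..<sum_list mu}. lconst (f (gbasis p)) *
      (\<Sum>r\<in>row_group mu. \<Sum>q\<in>column_group mu.
        of_int (sign q) * (\<Prod>k<sum_list mu. lvar (i (p k)) (j (t (r (q k)))))))"
proof -
  interpret f: Vector_Spaces.linear gscale "(*)" f by (rule f)
  let ?A = "{..<sum_list mu}"
  define P where "P = fiber_perms ?A (\<lambda>_. ())"
  have P: "{\<sigma>. \<sigma> permutes ?A} = P" by (auto simp: P_def fiber_perms_def)
  define \<Phi> where "\<Phi> \<sigma> = (\<Prod>k\<in>?A. lvar (i (\<sigma> k)) (j k))" for \<sigma> :: "nat \<Rightarrow> nat"
  have RC: "r permutes ?A" "q permutes ?A" if "r \<in> row_group mu" "q \<in> column_group mu" for r q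
    using that by (auto simp: row_group_def column_group_def)
  have fy: "lconst (f (gleft \<sigma> (gleft t (young_symmetrizer mu)))) =
      (\<Sum>r\<in>row_group mu. \<Sum>q\<in>column_group mu. of_int (sign q) * lconst (f (gbasis (\<sigma> \<circ> (t \<circ> (r \<circ> q))))))"
    if s: "\<sigma> permutes ?A" for \<sigma>
  proof -
    have gb: "gleft \<sigma> (gleft t (gbasis (r \<circ> q))) = gbasis (\<sigma> \<circ> (t \<circ> (r \<circ> q)))" for r q
      by (simp only: gleft_gbasis[OF permutes_bij[OF t]] gleft_gbasis[OF permutes_bij[OF s]])
    then show ?thesis
      by (simp only: young_symmetrizer_def gleft_sum gleft_gscale f.sum f.scale lconst_sum
          lconst_mult lconst_of_int gb)
  qed
  \<comment> \<open>Right translation of the summation variable by \<open>u\<close>, followed by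
    reindexing the product over \<open>k\<close> by \<open>u\<close>.\<close>
  have shift: "(\<Sum>\<sigma>\<in>P. lconst (f (gbasis (\<sigma> \<circ> u))) * \<Phi> \<sigma>) =
      (\<Sum>p\<in>P. lconst (f (gbasis p)) * (\<Prod>k\<in>?A. lvar (i (p k)) (j (u k))))"
    if u: "u permutes ?A" for u
  proof -
    have uP: "u \<in> fiber_perms ?A (\<lambda>_. ())" using u by (simp add: fiber_perms_def)
    have "(\<Sum>\<sigma>\<in>P. lconst (f (gbasis (\<sigma> \<circ> u))) * \<Phi> (\<sigma> \<circ> u \<circ> pinv u)) =
        (\<Sum>p\<in>P. lconst (f (gbasis p)) * \<Phi> (p \<circ> pinv u))"
      unfolding P_def
      by (rule sum_fiber_perms_compose_right[OF uP, of "\<lambda>p. lconst (f (gbasis p)) * \<Phi> (p \<circ> pinv u)"])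
    moreover have "\<sigma> \<circ> u \<circ> pinv u = \<sigma>" for \<sigma> :: "nat \<Rightarrow> nat"
      using permutes_inv_o(1)[OF u] by (simp add: comp_assoc)
    moreover have "\<Phi> (p \<circ> pinv u) = (\<Prod>k\<in>?A. lvar (i (p k)) (j (u k)))" for p
      unfolding \<Phi>_def using prod.permute[OF u, of "\<lambda>k. lvar (i (p (pinv u k))) (j k)"]
      by (simp add: o_def permutes_inverses(2)[OF u])
    ultimately show ?thesis by simp
  qed
  have "(\<Sum>\<sigma>\<in>P. lconst (f (gleft \<sigma> (gleft t (young_symmetrizer mu)))) * \<Phi> \<sigma>) =
    (\<Sum>\<sigma>\<in>P. \<Sum>r\<in>row_group mu. \<Sum>q\<in>column_group mu.
      of_int (sign q) * (lconst (f (gbasis (\<sigma> \<circ> (t \<circ> (r \<circ> q))))) * \<Phi> \<sigma>))"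
    by (intro sum.cong refl) (simp add: P[symmetric] fy sum_distrib_right mult.assoc)
  also have "\<dots> = (\<Sum>r\<in>row_group mu. \<Sum>q\<in>column_group mu. of_int (sign q) *
      (\<Sum>\<sigma>\<in>P. lconst (f (gbasis (\<sigma> \<circ> (t \<circ> (r \<circ> q))))) * \<Phi> \<sigma>))"
    unfolding sum_distrib_left
    by (rule trans[OF sum.swap], rule sum.cong[OF refl], rule sum.swap)
  also have "\<dots> = (\<Sum>r\<in>row_group mu. \<Sum>q\<in>column_group mu. of_int (sign q) *
      (\<Sum>p\<in>P. lconst (f (gbasis p)) * (\<Prod>k\<in>?A. lvar (i (p k)) (j (t (r (q k)))))))"
  proof (rule sum.cong[OF refl], rule sum.cong[OF refl])
    fix r q assume "r \<in> row_group mu" "q \<in> column_group mu"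
    from RC[OF this] have "(t \<circ> (r \<circ> q)) permutes ?A" using t by (intro permutes_compose)
    from shift[OF this] show "of_int (sign q) * (\<Sum>\<sigma>\<in>P. lconst (f (gbasis (\<sigma> \<circ> (t \<circ> (r \<circ> q))))) * \<Phi> \<sigma>) =
        of_int (sign q) * (\<Sum>p\<in>P. lconst (f (gbasis p)) * (\<Prod>k\<in>?A. lvar (i (p k)) (j (t (r (q k))))))"
      by (simp only: o_apply)
  qed
  also have "\<dots> = (\<Sum>r\<in>row_group mu. \<Sum>p\<in>P. \<Sum>q\<in>column_group mu. lconst (f (gbasis p)) *
      (of_int (sign q) * (\<Prod>k\<in>?A. lvar (i (p k)) (j (t (r (q k)))))))"
    unfolding sum_distrib_left mult.left_commute[of "of_int _"]
    by (rule sum.cong[OF refl], rule sum.swap)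
  also have "\<dots> = (\<Sum>p\<in>P. lconst (f (gbasis p)) * (\<Sum>r\<in>row_group mu. \<Sum>q\<in>column_group mu.
        of_int (sign q) * (\<Prod>k\<in>?A. lvar (i (p k)) (j (t (r (q k)))))))"
    unfolding sum_distrib_left by (rule sum.swap)
  finally show ?thesis unfolding P \<Phi>_def .
qed

text \<open>The sum is linear in \<open>x\<close>, which reduces the claim to the translates of the
  Young symmetrizer that span the module.\<close>

lemma sum_functional_specht_module:
  fixes f :: "galg \<Rightarrow> complex" and i j :: "nat \<Rightarrow> nat"
  assumes f: "Vector_Spaces.linear gscale (*) f"
    and x: "x \<in> specht_module mu"
    and W: "\<And>p t. p permutes {..<sum_list mu} \<Longrightarrow> t permutes {..<sum_list mu} \<Longrightarrow>
      (\<Sum>r\<in>row_group mu. \<Sum>q\<in>column_group mu.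
        of_int (sign q) * (\<Prod>k<sum_list mu. lvar (i (p k)) (j (t (r (q k)))))) \<in> lp.span W"
  shows "(\<Sum>\<sigma> | \<sigma> permutes {..<sum_list mu}.
      lconst (f (gleft \<sigma> x)) * (\<Prod>k<sum_list mu. lvar (i (\<sigma> k)) (j k))) \<in> lp.span W"
  using x unfolding specht_module_def
proof (induction rule: galg.span_induct_alt)
  interpret f: Vector_Spaces.linear gscale "(*)" f by (rule f)
  let ?\<Phi> = "\<lambda>\<sigma>. \<Prod>k<sum_list mu. lvar (i (\<sigma> k)) (j k)"
  case base
  show ?case by (simp only: gleft_zero f.zero lconst_0 mult_zero_left sum.neutral_const lp.span_zero)
  case (step c x y)
  then obtain t where t: "x = gleft t (young_symmetrizer mu)" "t permutes {..<sum_list mu}" by auto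
  have "(\<Sum>\<sigma> | \<sigma> permutes {..<sum_list mu}. lconst (f (gleft \<sigma> x)) * ?\<Phi> \<sigma>) \<in> lp.span W"
    unfolding t(1) sum_functional_young_orbit[OF f t(2)]
    by (rule lp.span_sum, rule lp_span_lconst, rule W) (use t(2) in simp_all)
  moreover have "(\<Sum>\<sigma> | \<sigma> permutes {..<sum_list mu}. lconst (f (gleft \<sigma> (gscale c x + y))) * ?\<Phi> \<sigma>) =
      lconst c * (\<Sum>\<sigma> | \<sigma> permutes {..<sum_list mu}. lconst (f (gleft \<sigma> x)) * ?\<Phi> \<sigma>) +
      (\<Sum>\<sigma> | \<sigma> permutes {..<sum_list mu}. lconst (f (gleft \<sigma> y)) * ?\<Phi> \<sigma>)"
    by (simp only: gleft_add gleft_gscale f.add f.scale lconst_add lconst_mult distrib_right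
        sum.distrib sum_distrib_left mult.assoc)
  ultimately show ?case using step(2) by (simp only: lp.span_add lp_span_lconst)
qed

text \<open>The trace adds up diagonal coordinates. Coordinates with respect to \<open>B\<close> are
  linear only on the span of \<open>B\<close>, so \<open>B\<close> is extended to a basis of the
  whole space; on the Specht module, which \<open>gleft s\<close> preserves, the old and the new
  coordinates agree.\<close>

lemma specht_character_eq_sum_functionals:
  obtains B f where "B \<subseteq> specht_module mu" "\<And>b. Vector_Spaces.linear gscale (*) (f b)"
    "\<And>s. s permutes {..<sum_list mu} \<Longrightarrow> specht_character mu s = (\<Sum>b\<in>B. f b (gleft s b))"
proof -
  let ?V = "specht_module mu"
  define B where "B = (SOME B. B \<subseteq> ?V \<and> \<not> galg.dependent B \<and> galg.span B = ?V)"
  \<comment> \<open>Some basis of the module exists, so the one chosen in \<open>trace_on\<close>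
    really is a basis.\<close>
  obtain B' where "B' \<subseteq> ?V" "\<not> galg.dependent B'" "?V \<subseteq> galg.span B'"
    using galg.maximal_independent_subset[of ?V] by auto
  moreover have "galg.span B' \<subseteq> ?V"
    using \<open>B' \<subseteq> ?V\<close> unfolding specht_module_def
    by (intro galg.span_minimal galg.subspace_span)
  ultimately have "\<exists>B. B \<subseteq> ?V \<and> \<not> galg.dependent B \<and> galg.span B = ?V" by blast
  from someI_ex[OF this] have B: "B \<subseteq> ?V" "\<not> galg.dependent B" "galg.span B = ?V"
    unfolding B_def[symmetric] by auto
  let ?E = "galg.extend_basis B"
  define f where "f b v = galg.representation ?E v b" for b v
  have "Vector_Spaces.linear gscale (*) (f b)" for b
    unfolding f_def
    by (intro galg.linear_representation galg.independent_extend_basis galg.span_extend_basis B)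
  moreover have "specht_character mu s = (\<Sum>b\<in>B. f b (gleft s b))"
    if s: "s permutes {..<sum_list mu}" for s
  proof -
    have "galg.representation B (gleft s b) b = f b (gleft s b)" if "b \<in> B" for b
    proof -
      have "gleft s b \<in> galg.span B" using gleft_specht_module[OF s] that B by auto
      then show ?thesis
        using galg.representation_extend[OF galg.independent_extend_basis[OF B(2)] _
            galg.extend_basis_superset[OF B(2)]] by (simp add: f_def)
    qed
    then show ?thesis
      by (simp add: specht_character_def trace_on_def B_def[symmetric])
  qed
  ultimately show ?thesis using that B(1) by blast
qed

subsection \<open>Immanants\<close>

text \<open>Coefficients are attached to pairs and not to polynomials, because distinct pairs may
  give the same \<open>F U V\<close>. Each step of the span induction changes a single
  coefficient.\<close>

lemma lp_span_imp_coefficients: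
  fixes F :: "'a \<Rightarrow> 'b \<Rightarrow> lpoly"
  assumes fin: "finite A" "finite B"
    and p: "p \<in> lp.span {F U V | U V. U \<in> A \<and> V \<in> B}"
  shows "\<exists>\<rho>. p = (\<Sum>U\<in>A. \<Sum>V\<in>B. lconst (\<rho> U V) * F U V)"
  using p
proof (induction rule: lp.span_induct_alt)
  case base
  have "0 = (\<Sum>U\<in>A. \<Sum>V\<in>B. lconst 0 * F U V)" by simp
  then show ?case by (intro exI[of _ "\<lambda>_ _. 0"])
next
  case (step c x y)
  then obtain U0 V0 \<rho> where x: "x = F U0 V0" "U0 \<in> A" "V0 \<in> B"
    and y: "y = (\<Sum>U\<in>A. \<Sum>V\<in>B. lconst (\<rho> U V) * F U V)" by blast
  let ?\<delta> = "\<lambda>U V. if U = U0 then if V = V0 then c else 0 else 0"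
  have "(\<Sum>U\<in>A. \<Sum>V\<in>B. lconst (?\<delta> U V) * F U V) =
      (\<Sum>U\<in>A. if U = U0 then \<Sum>V\<in>B. if V = V0 then lconst c * F U V else 0 else 0)"
    by (intro sum.cong refl) (auto intro!: sum.cong)
  also have "\<dots> = lconst c * F U0 V0" using fin x by simp
  finally have "lpscale c x + y = (\<Sum>U\<in>A. \<Sum>V\<in>B. lconst (?\<delta> U V + \<rho> U V) * F U V)"
    by (simp only: lpscale_def x(1) y lconst_add distrib_right sum.distrib)
  then show ?case by (intro exI[of _ "\<lambda>U V. ?\<delta> U V + \<rho> U V"])
qed

section \<open>Homogeneous components\<close>

lemma hom_component_mult:
  assumes p: "p \<in> hom_component n d a" and q: "q \<in> hom_component n d b"
  shows "p * q \<in> hom_component n d (a + b)"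
  unfolding hom_component_def
proof safe
  fix m assume "m \<in> Poly_Mapping.keys (p * q)"
  then obtain u v where m: "m = u + v" "u \<in> Poly_Mapping.keys p" "v \<in> Poly_Mapping.keys q"
    using keys_mult[of p q] by blast
  have uv: "Poly_Mapping.keys u \<subseteq> {1..n} \<times> {1..d}" "Poly_Mapping.keys v \<subseteq> {1..n} \<times> {1..d}"
    "(\<Sum>x\<in>Poly_Mapping.keys u. Poly_Mapping.lookup u x) = a"
    "(\<Sum>x\<in>Poly_Mapping.keys v. Poly_Mapping.lookup v x) = b"
    using p q m(2,3) unfolding hom_component_def by auto
  show "x \<in> {1..n}" "y \<in> {1..d}" if "(x, y) \<in> Poly_Mapping.keys m" for x y
    using that keys_add[of u v] uv(1,2) unfolding m(1) by blast+
  show "(\<Sum>x\<in>Poly_Mapping.keys m. Poly_Mapping.lookup m x) = a + b"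
    unfolding m(1) using setsum_keys_plus_distrib[of "\<lambda>_ c. c" u v] uv(3,4) by simp
qed

lemma hom_component_lconst: "lconst a \<in> hom_component n d 0"
  by (auto simp: hom_component_def lconst_def)

lemma hom_component_lvar: "i \<in> {1..n} \<Longrightarrow> j \<in> {1..d} \<Longrightarrow> lvar i j \<in> hom_component n d 1"
  by (auto simp: hom_component_def lvar_def)

lemma hom_component_prod_lvar:
  assumes "\<And>k. k < m \<Longrightarrow> a k \<in> {1..n}" "\<And>k. k < m \<Longrightarrow> b k \<in> {1..d}"
  shows "(\<Prod>k<m. lvar (a k) (b k)) \<in> hom_component n d m"
  using assms
proof (induction m)
  case 0
  show ?case using hom_component_lconst[of 1 n d] by simp
next
  case (Suc m)
  have "(\<Prod>k<m. lvar (a k) (b k)) * lvar (a m) (b m) \<in> hom_component n d (m + 1)"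
    by (rule hom_component_mult[OF Suc.IH hom_component_lvar]) (use Suc.prems in simp_all)
  then show ?case by simp
qed

lemma hom_component_sum:
  assumes "\<And>x. x \<in> A \<Longrightarrow> f x \<in> hom_component n d h"
  shows "sum f A \<in> hom_component n d h"
  using assms
proof (induction A rule: infinite_finite_induct)
  case (insert x F)
  then have "f x \<in> hom_component n d h" "sum f F \<in> hom_component n d h" by simp_all
  then show ?case
    using keys_add[of "f x" "sum f F"] insert.hyps unfolding hom_component_def by auto
qed (simp_all add: hom_component_def)

theorem proposition2p12:
  fixes n d h :: nat and lam iw jw :: "nat list"
  assumes "n \<ge> 1" and "d \<ge> 1" and "h \<ge> 1"
    and "is_partition lam h"
    and "length iw = h" and "set iw \<subseteq> {1..n}"
    and "length jw = h" and "set jw \<subseteq> {1..d}"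
  shows "imm lam iw jw \<in> hom_component n d h \<and>
    (\<exists>\<rho> :: tableau \<Rightarrow> tableau \<Rightarrow> complex.
       imm lam iw jw =
         (\<Sum>U \<in> standard_tableaux lam n. \<Sum>V \<in> standard_tableaux lam d.
            lconst (\<rho> U V) * right_sym_bitableau U V))"
proof -
  note lam = \<open>is_partition lam h\<close>
  define mu where "mu = conj_partition lam"
  have mu: "sum_list mu = h" unfolding mu_def by (rule sum_list_conj_partition[OF lam])
  define W where "W = {right_sym_bitableau U V | U V. U \<in> standard_tableaux lam n \<and> V \<in> standard_tableaux lam d}"
  define \<Phi> where "\<Phi> \<sigma> = (\<Prod>k<h. lvar (iw ! \<sigma> k) (jw ! k))" for \<sigma> :: "nat \<Rightarrow> nat"
  \<comment> \<open>The sign common to all column bitableaux of length \<open>h\<close>.\<close>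
  define s where "s = lconst ((-1) ^ (h choose 2))"
  have iw: "iw ! k \<in> {1..n}" and jw: "jw ! k \<in> {1..d}" if "k < h" for k
    using that assms nth_mem[of k iw] nth_mem[of k jw] by (simp_all only: subset_iff)
  have "column_bitableau (map (\<lambda>k. iw ! \<sigma> k) [0..<length iw]) jw = s * \<Phi> \<sigma>" for \<sigma>
  proof -
    have "s = (-1) ^ (h choose 2)"
      using lconst_of_int[of "(-1) ^ (h choose 2)"] by (simp add: s_def)
    then show ?thesis using assms by (simp add: column_bitableau_eq \<Phi>_def)
  qed
  then have imm: "imm lam iw jw = (\<Sum>\<sigma> | \<sigma> permutes {..<h}. lconst (specht_character mu \<sigma>) * (s * \<Phi> \<sigma>))"
    using assms by (simp add: imm_def irr_character_def mu_def)
  have "imm lam iw jw \<in> hom_component n d h"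
    unfolding imm
  proof (rule hom_component_sum)
    fix \<sigma> assume "\<sigma> \<in> {\<sigma>. \<sigma> permutes {..<h}}"
    then have "\<sigma> k < h" if "k < h" for k using that permutes_in_image[of \<sigma> "{..<h}" k] by simp
    then have "\<Phi> \<sigma> \<in> hom_component n d h"
      unfolding \<Phi>_def using iw jw by (intro hom_component_prod_lvar) blast+
    then have "lconst (specht_character mu \<sigma>) * (s * \<Phi> \<sigma>) \<in> hom_component n d (0 + (0 + h))"
      unfolding s_def by (intro hom_component_mult hom_component_lconst)
    then show "lconst (specht_character mu \<sigma>) * (s * \<Phi> \<sigma>) \<in> hom_component n d h" by simp
  qed
  moreover have "imm lam iw jw \<in> lp.span W"
  proof -
    obtain B f where B: "B \<subseteq> specht_module mu" and f: "\<And>b. Vector_Spaces.linear gscale (*) (f b)"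
      and char: "\<And>s. s permutes {..<sum_list mu} \<Longrightarrow> specht_character mu s = (\<Sum>b\<in>B. f b (gleft s b))"
      using specht_character_eq_sum_functionals[of mu] by blast
    \<comment> \<open>After relabelling, the sum over the two Young groups is the
      \<open>symsum\<close> of fillings with entries from the two words, to which straightening
      applies.\<close>
    have gen: "(\<Sum>r\<in>row_group mu. \<Sum>q\<in>column_group mu.
        of_int (sign q) * (\<Prod>k<sum_list mu. lvar (iw ! p k) (jw ! t (r (q k))))) \<in> lp.span W"
      if p: "p permutes {..<sum_list mu}" and t: "t permutes {..<sum_list mu}" for p t
    proof -
      let ?e' = "inv_into {..<h} (conj_cell lam)"
      have e': "?e' z < h" if "z \<in> cells lam" for z
        using bij_betwE[OF bij_betw_inv_into[OF bij_betw_conj_cell[OF lam]]] that by auto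
      have "symsum lam ((\<lambda>k. iw ! p k) \<circ> ?e') ((\<lambda>k. jw ! t k) \<circ> ?e') \<in> lp.span W"
        unfolding W_def
      proof (rule symsum_in_span_standard[OF lam])
        have "p k < h" "t k < h" if "k < h" for k
          using that permutes_in_image[OF p, of k] permutes_in_image[OF t, of k] mu by simp_all
        then show "((\<lambda>k. iw ! p k) \<circ> ?e') ` cells lam \<subseteq> {1..n}"
          "((\<lambda>k. jw ! t k) \<circ> ?e') ` cells lam \<subseteq> {1..d}"
          using e' iw jw by (auto simp del: atLeastAtMost_iff)
      qed
      then show ?thesis
        using sum_young_groups_eq_symsum[OF lam, of "\<lambda>k. iw ! p k" "\<lambda>k. jw ! t k"] mu
        by (simp add: mu_def)
    qed
    \<comment> \<open>Interchanging the sums leaves, for each basis element \<open>b\<close>, one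
      linear functional applied to translates of one module element.\<close>
    have "imm lam iw jw = (\<Sum>\<sigma> | \<sigma> permutes {..<h}. \<Sum>b\<in>B. s * (lconst (f b (gleft \<sigma> b)) * \<Phi> \<sigma>))"
      unfolding imm
      by (rule sum.cong[OF refl])
         (simp add: char[unfolded mu] lconst_sum sum_distrib_left sum_distrib_right mult_ac)
    also have "\<dots> = s * (\<Sum>b\<in>B. \<Sum>\<sigma> | \<sigma> permutes {..<sum_list mu}. lconst (f b (gleft \<sigma> b)) * \<Phi> \<sigma>)"
      unfolding mu sum_distrib_left by (rule sum.swap)
    also have "\<dots> \<in> lp.span W"
      unfolding s_def
    proof (rule lp_span_lconst, rule lp.span_sum)
      fix b assume "b \<in> B"
      then have "b \<in> specht_module mu" using B by blast
      from sum_functional_specht_module[where i = "(!) iw" and j = "(!) jw", OF f this gen]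
      show "(\<Sum>\<sigma> | \<sigma> permutes {..<sum_list mu}. lconst (f b (gleft \<sigma> b)) * \<Phi> \<sigma>) \<in> lp.span W"
        by (simp add: \<Phi>_def mu)
    qed
    finally show ?thesis .
  qed
  then have "\<exists>\<rho>. imm lam iw jw =
      (\<Sum>U \<in> standard_tableaux lam n. \<Sum>V \<in> standard_tableaux lam d.
         lconst (\<rho> U V) * right_sym_bitableau U V)"
    unfolding W_def by (intro lp_span_imp_coefficients finite_standard_tableaux)
  ultimately show ?thesis by blast
qed

end
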